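(* Let $G$ be a group, $\mathbf X$ a $G$-category, and let $F:\mathbf X\to\mathbf Y$, $U:\mathbf Y\to\mathbf X$, $\eta:1_{\mathbf X}\to UF$, $\varepsilon:FU\to1_{\mathbf Y}$ be a $G$-Galois adjunction. Then for every object $Y_0$ of $\mathbf Y$ there is a category equivalence $$\mathbf Y[Y_0]\sim Z^1(G,\mathrm{End}(U(Y_0))_{\xi_0}),$$ in which $\mathbf Y[Y_0]$ is the full subcategory of $\mathbf Y$ with objects all $Y$ in $\mathbf Y$ with $U(Y)$ isomorphic to $U(Y_0)$, and $(U(Y_0),\xi_0)=\bigl(U(Y_0),(U(\varepsilon_{Y_0})\,\eta_{g(U(Y_0))})_{g\in G}\bigr)$ is the $1$-cocycle $G\to\mathbf X$ corresponding to $Y_0$. In particular, the set of isomorphism classes of objects in $\mathbf Y[Y_0]$ is bijective to $$H^1(G,\mathrm{End}(U(Y_0))_{\xi_0})=H^1(G,\mathrm{Aut}(U(Y_0))_{\xi_0}).$$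
   Context: A $G$-category is a category $\mathbf X$ equipped with functors $g(-):\mathbf X\to\mathbf X$ ($g\in G$) such that $1(-)=1_{\mathbf X}$ and $(hg)(-)=h(-)\,g(-)$ (strict equalities). A $1$-cocycle $(X,\xi):G\to\mathbf X$ is an object $X$ with a family $\xi=(\xi_g)_{g\in G}$ of morphisms $\xi_g:g(X)\to X$ satisfying $\xi_1=1_X$ and $\xi_{hg}=\xi_h\,h(\xi_g)$ for all $g,h\in G$ (each $\xi_g$ is then an isomorphism). A morphism $f:(X,\xi)\to(X',\xi')$ is a morphism $f:X\to X'$ in $\mathbf X$ with $f\xi_g=\xi'_g\,g(f)$ for all $g$. This gives the category $Z^1(G,\mathbf X)$; $H^1(G,\mathbf X)$ is the set of isomorphism classes of its objects. The adjunction ($F$ left adjoint to $U$) is a $G$-Galois adjunction if: (i) $F(g(-))=F$ for all $g\in G$; (ii) $\mathbf X$ admits $G$-indexed coproducts and, for each object $X$ of $\mathbf X$, the morphism $\coprod_{g\in G}g(X)\to UF(X)$ induced by the morphisms $\eta_{g(X)}:g(X)\to UF(g(X))=UF(X)$ is an isomorphism; (iii) $U$ is monadic. For a $1$-cocycle $(X,\xi):G\to\mathbf X$, $\mathrm{End}(X)_\xi$ denotes the endomorphism monoid $\mathrm{End}(X)$ of $X$ in $\mathbf X$, regarded as a one-object category, with the $G$-category structure $ga=\xi_g\,g(a)\,(\xi_g)^{-1}$ for $g\in G$, $a\in\mathrm{End}(X)$; it restricts to a $G$-group structure on $\mathrm{Aut}(X)$, giving $\mathrm{Aut}(X)_\xi$,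 also regarded as a one-object $G$-category. Explicitly, an object of $Z^1(G,\mathrm{End}(X)_\xi)$ is a map $\varphi:G\to\mathrm{End}(X)$ with $\varphi(1)=1$ and $\varphi(hg)=\varphi(h)\cdot(h\varphi(g))$, and a morphism $\varphi\to\psi$ is an $a\in\mathrm{End}(X)$ with $a\varphi(g)=\psi(g)\cdot(ga)$ for all $g\in G$; similarly for $\mathrm{Aut}(X)_\xi$. *)

theory Defs
  imports "HOL-Algebra.Group"
begin

section \<open>Categories\<close>

text \<open>Composition is written in applicative order: \<open>g \<cdot> f\<close> is \<open>g\<close> after \<open>f\<close>. Values of the
  operations outside the sets of objects, arrows and composable pairs are irrelevant.\<close>

record ('o, 'm) category =
  Ob :: "'o set"
  Arr :: "'m set"
  Dom :: "'m \<Rightarrow> 'o"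
  Cod :: "'m \<Rightarrow> 'o"
  Ident :: "'o \<Rightarrow> 'm"
  Comp :: "'m \<Rightarrow> 'm \<Rightarrow> 'm" (infixr \<open>\<cdot>\<index>\<close> 70)

definition Hom :: "('o, 'm) category \<Rightarrow> 'o \<Rightarrow> 'o \<Rightarrow> 'm set" where
  "Hom C a b = {f \<in> Arr C. Dom C f = a \<and> Cod C f = b}"

locale category =
  fixes C :: "('o, 'm) category" (structure)
  assumes Dom_closed: "f \<in> Arr C \<Longrightarrow> Dom C f \<in> Ob C"
    and Cod_closed: "f \<in> Arr C \<Longrightarrow> Cod C f \<in> Ob C"
    and Id_closed: "a \<in> Ob C \<Longrightarrow> Ident C a \<in> Hom C a a"
    and Comp_closed: "\<lbrakk>f \<in> Hom C a b; g \<in> Hom C b c\<rbrakk> \<Longrightarrow> g \<cdot> f \<in> Hom C a c"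
    and Id_left: "f \<in> Hom C a b \<Longrightarrow> Ident C b \<cdot> f = f"
    and Id_right: "f \<in> Hom C a b \<Longrightarrow> f \<cdot> Ident C a = f"
    and Comp_assoc: "\<lbrakk>f \<in> Hom C a b; g \<in> Hom C b c; h \<in> Hom C c d\<rbrakk>
      \<Longrightarrow> (h \<cdot> g) \<cdot> f = h \<cdot> (g \<cdot> f)"

definition inverse_arrows :: "('o, 'm) category \<Rightarrow> 'm \<Rightarrow> 'm \<Rightarrow> bool" where
  "inverse_arrows C f g \<longleftrightarrow>
     f \<in> Arr C \<and> g \<in> Hom C (Cod C f) (Dom C f) \<and>
     g \<cdot>\<^bsub>C\<^esub> f = Ident C (Dom C f) \<and> f \<cdot>\<^bsub>C\<^esub> g = Ident C (Cod C f)"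

definition is_iso :: "('o, 'm) category \<Rightarrow> 'm \<Rightarrow> bool" where
  "is_iso C f \<longleftrightarrow> (\<exists>g. inverse_arrows C f g)"

definition inv_arrow :: "('o, 'm) category \<Rightarrow> 'm \<Rightarrow> 'm" where
  "inv_arrow C f = (THE g. inverse_arrows C f g)"

definition isomorphic :: "('o, 'm) category \<Rightarrow> 'o \<Rightarrow> 'o \<Rightarrow> bool" where
  "isomorphic C a b \<longleftrightarrow> (\<exists>f \<in> Hom C a b. is_iso C f)"

definition iso_classes :: "('o, 'm) category \<Rightarrow> 'o set set" where
  "iso_classes C = Ob C // {(a, b). a \<in> Ob C \<and> b \<in> Ob C \<and> isomorphic C a b}"

definition full_subcategory :: "('o, 'm) category \<Rightarrow> 'o set \<Rightarrow> ('o, 'm) category" where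
  "full_subcategory C S =
     C\<lparr>Ob := Ob C \<inter> S, Arr := {f \<in> Arr C. Dom C f \<in> S \<and> Cod C f \<in> S}\<rparr>"

text \<open>A family \<open>A\<close> of objects indexed by \<open>I\<close>, with \<open>c\<close> and the injections \<open>i\<close> as a coproduct.\<close>

definition is_coproduct ::
  "('o, 'm) category \<Rightarrow> 'i set \<Rightarrow> ('i \<Rightarrow> 'o) \<Rightarrow> 'o \<Rightarrow> ('i \<Rightarrow> 'm) \<Rightarrow> bool" where
  "is_coproduct C I A c i \<longleftrightarrow>
     c \<in> Ob C \<and> (\<forall>k\<in>I. i k \<in> Hom C (A k) c) \<and>
     (\<forall>d\<in>Ob C. \<forall>j. (\<forall>k\<in>I. j k \<in> Hom C (A k) d) \<longrightarrow>
        (\<exists>!u. u \<in> Hom C c d \<and> (\<forall>k\<in>I. u \<cdot>\<^bsub>C\<^esub> i k = j k)))"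

definition has_coproducts :: "('o, 'm) category \<Rightarrow> 'i set \<Rightarrow> bool" where
  "has_coproducts C I \<longleftrightarrow>
     (\<forall>A. (\<forall>k\<in>I. A k \<in> Ob C) \<longrightarrow> (\<exists>c i. is_coproduct C I A c i))"

section \<open>Functors, natural transformations, equivalences\<close>

record ('o, 'm, 'p, 'n) functor_data =
  omap :: "'o \<Rightarrow> 'p"
  amap :: "'m \<Rightarrow> 'n"

locale is_functor = C: category C + D: category D
  for C :: "('o, 'm) category" and D :: "('p, 'n) category" +
  fixes F :: "('o, 'm, 'p, 'n) functor_data"
  assumes omap_closed: "a \<in> Ob C \<Longrightarrow> omap F a \<in> Ob D"
    and amap_closed: "f \<in> Hom C a b \<Longrightarrow> amap F f \<in> Hom D (omap F a) (omap F b)"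
    and amap_Id: "a \<in> Ob C \<Longrightarrow> amap F (Ident C a) = Ident D (omap F a)"
    and amap_Comp: "\<lbrakk>f \<in> Hom C a b; g \<in> Hom C b c\<rbrakk>
      \<Longrightarrow> amap F (g \<cdot>\<^bsub>C\<^esub> f) = amap F g \<cdot>\<^bsub>D\<^esub> amap F f"

definition id_functor :: "('o, 'm, 'o, 'm) functor_data" where
  "id_functor = \<lparr>omap = (\<lambda>a. a), amap = (\<lambda>f. f)\<rparr>"

definition comp_functor ::
  "('p, 'n, 'q, 'k) functor_data \<Rightarrow> ('o, 'm, 'p, 'n) functor_data \<Rightarrow> ('o, 'm, 'q, 'k) functor_data"
  (infixr \<open>\<circ>\<^sub>F\<close> 75) where
  "comp_functor S T = \<lparr>omap = (\<lambda>a. omap S (omap T a)), amap = (\<lambda>f. amap S (amap T f))\<rparr>"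

definition functor_eq ::
  "('o, 'm) category \<Rightarrow> ('o, 'm, 'p, 'n) functor_data \<Rightarrow> ('o, 'm, 'p, 'n) functor_data \<Rightarrow> bool" where
  "functor_eq C S T \<longleftrightarrow>
     (\<forall>a\<in>Ob C. omap S a = omap T a) \<and> (\<forall>f\<in>Arr C. amap S f = amap T f)"

locale natural_transformation = S: is_functor C D S + T: is_functor C D T
  for C :: "('o, 'm) category" and D :: "('p, 'n) category" and S T +
  fixes \<tau> :: "'o \<Rightarrow> 'n"
  assumes component: "a \<in> Ob C \<Longrightarrow> \<tau> a \<in> Hom D (omap S a) (omap T a)"
    and naturality: "f \<in> Hom C a b \<Longrightarrow> \<tau> b \<cdot>\<^bsub>D\<^esub> amap S f = amap T f \<cdot>\<^bsub>D\<^esub> \<tau> a"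

locale natural_isomorphism = natural_transformation +
  assumes component_iso: "a \<in> Ob C \<Longrightarrow> is_iso D (\<tau> a)"

definition is_equivalence ::
  "('o, 'm) category \<Rightarrow> ('p, 'n) category \<Rightarrow> ('o, 'm, 'p, 'n) functor_data \<Rightarrow> bool" where
  "is_equivalence C D S \<longleftrightarrow> is_functor C D S \<and>
     (\<exists>T. is_functor D C T \<and>
        (\<exists>\<alpha>. natural_isomorphism C C id_functor (T \<circ>\<^sub>F S) \<alpha>) \<and>
        (\<exists>\<beta>. natural_isomorphism D D (S \<circ>\<^sub>F T) id_functor \<beta>))"

definition equivalent_categories :: "('o, 'm) category \<Rightarrow> ('p, 'n) category \<Rightarrow> bool" where
  "equivalent_categories C D \<longleftrightarrow> (\<exists>S. is_equivalence C D S)"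

section \<open>Categories of objects with structure\<close>

text \<open>Both Eilenberg-Moore algebras and 1-cocycles are objects of \<open>C\<close> with extra structure, and
  their morphisms are the arrows \<open>f\<close> of \<open>C\<close> satisfying a compatibility condition \<open>P\<close>. Source and
  target are recorded in the arrow \<open>(A, f, B)\<close>, as the same \<open>f\<close> may underlie several morphisms.\<close>

definition structured_category ::
  "('o, 'm) category \<Rightarrow> ('o \<times> 's) set \<Rightarrow> ('o \<times> 's \<Rightarrow> 'm \<Rightarrow> 'o \<times> 's \<Rightarrow> bool) \<Rightarrow>
     ('o \<times> 's, ('o \<times> 's) \<times> 'm \<times> ('o \<times> 's)) category" where
  "structured_category C S P =
     \<lparr>Ob = S,
      Arr = {(A, f, B). A \<in> S \<and> B \<in> S \<and> f \<in> Hom C (fst A) (fst B) \<and> P A f B},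
      Dom = (\<lambda>(A, f, B). A),
      Cod = (\<lambda>(A, f, B). B),
      Ident = (\<lambda>A. (A, Ident C (fst A), A)),
      Comp = (\<lambda>(B, g, E) (A, f, B'). (A, g \<cdot>\<^bsub>C\<^esub> f, E))\<rparr>"

section \<open>Adjunctions and monadicity\<close>

locale adjunction =
  F: is_functor X Y F + U: is_functor Y X U +
  unit: natural_transformation X X id_functor "U \<circ>\<^sub>F F" \<eta> +
  counit: natural_transformation Y Y "F \<circ>\<^sub>F U" id_functor \<epsilon>
  for X :: "('o, 'm) category" and Y :: "('p, 'n) category" and F U \<eta> \<epsilon> +
  assumes triangle_F: "x \<in> Ob X \<Longrightarrow> \<epsilon> (omap F x) \<cdot>\<^bsub>Y\<^esub> amap F (\<eta> x) = Ident Y (omap F x)"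
    and triangle_U: "y \<in> Ob Y \<Longrightarrow> amap U (\<epsilon> y) \<cdot>\<^bsub>X\<^esub> \<eta> (omap U y) = Ident X (omap U y)"

text \<open>The category of algebras of the monad \<open>(T, \<eta>, \<mu>)\<close> on \<open>C\<close>.\<close>

definition eilenberg_moore ::
  "('o, 'm) category \<Rightarrow> ('o, 'm, 'o, 'm) functor_data \<Rightarrow> ('o \<Rightarrow> 'm) \<Rightarrow> ('o \<Rightarrow> 'm) \<Rightarrow>
     ('o \<times> 'm, ('o \<times> 'm) \<times> 'm \<times> ('o \<times> 'm)) category" where
  "eilenberg_moore C T \<eta> \<mu> =
     structured_category C
       {(x, \<theta>). x \<in> Ob C \<and> \<theta> \<in> Hom C (omap T x) x \<and>
          \<theta> \<cdot>\<^bsub>C\<^esub> \<eta> x = Ident C x \<and> \<theta> \<cdot>\<^bsub>C\<^esub> amap T \<theta> = \<theta> \<cdot>\<^bsub>C\<^esub> \<mu> x}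
       (\<lambda>(x, \<theta>) f (x', \<theta>'). f \<cdot>\<^bsub>C\<^esub> \<theta> = \<theta>' \<cdot>\<^bsub>C\<^esub> amap T f)"

definition comparison_functor ::
  "('p, 'n) category \<Rightarrow> ('p, 'n, 'o, 'm) functor_data \<Rightarrow> ('p \<Rightarrow> 'n) \<Rightarrow>
     ('p, 'n, 'o \<times> 'm, ('o \<times> 'm) \<times> 'm \<times> ('o \<times> 'm)) functor_data" where
  "comparison_functor Y U \<epsilon> =
     (let K = (\<lambda>y. (omap U y, amap U (\<epsilon> y)))
      in \<lparr>omap = K, amap = (\<lambda>f. (K (Dom Y f), amap U f, K (Cod Y f)))\<rparr>)"

text \<open>Monadicity of the right adjoint \<open>U\<close> up to equivalence (not isomorphism) of categories.\<close>

definition monadic ::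
  "('o, 'm) category \<Rightarrow> ('p, 'n) category \<Rightarrow> ('o, 'm, 'p, 'n) functor_data \<Rightarrow>
     ('p, 'n, 'o, 'm) functor_data \<Rightarrow> ('o \<Rightarrow> 'm) \<Rightarrow> ('p \<Rightarrow> 'n) \<Rightarrow> bool" where
  "monadic X Y F U \<eta> \<epsilon> \<longleftrightarrow>
     is_equivalence Y
       (eilenberg_moore X (U \<circ>\<^sub>F F) \<eta> (\<lambda>x. amap U (\<epsilon> (omap F x))))
       (comparison_functor Y U \<epsilon>)"

section \<open>Categories with a group action, and their 1-cocycles\<close>

locale G_category = group G + category X
  for G :: "('g, 'e) monoid_scheme" and X :: "('o, 'm) category" +
  fixes act :: "'g \<Rightarrow> ('o, 'm, 'o, 'm) functor_data"
  assumes act_functor: "g \<in> carrier G \<Longrightarrow> is_functor X X (act g)"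
    and act_one: "functor_eq X (act \<one>\<^bsub>G\<^esub>) id_functor"
    and act_mult: "\<lbrakk>h \<in> carrier G; g \<in> carrier G\<rbrakk>
      \<Longrightarrow> functor_eq X (act (h \<otimes>\<^bsub>G\<^esub> g)) (act h \<circ>\<^sub>F act g)"

text \<open>The families \<open>\<xi>\<close> are extensional on the carrier of \<open>G\<close>, so that equal cocycles are equal
  as elements of the type.\<close>

definition Z1 ::
  "('g, 'e) monoid_scheme \<Rightarrow> ('o, 'm) category \<Rightarrow> ('g \<Rightarrow> ('o, 'm, 'o, 'm) functor_data) \<Rightarrow>
     ('o \<times> ('g \<Rightarrow> 'm), ('o \<times> ('g \<Rightarrow> 'm)) \<times> 'm \<times> ('o \<times> ('g \<Rightarrow> 'm))) category" where
  "Z1 G X act =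
     structured_category X
       {(x, \<xi>). x \<in> Ob X \<and> \<xi> \<in> (\<Pi>\<^sub>E g\<in>carrier G. Hom X (omap (act g) x) x) \<and>
          \<xi> \<one>\<^bsub>G\<^esub> = Ident X x \<and>
          (\<forall>h\<in>carrier G. \<forall>g\<in>carrier G. \<xi> (h \<otimes>\<^bsub>G\<^esub> g) = \<xi> h \<cdot>\<^bsub>X\<^esub> amap (act h) (\<xi> g))}
       (\<lambda>(x, \<xi>) f (x', \<xi>'). \<forall>g\<in>carrier G. f \<cdot>\<^bsub>X\<^esub> \<xi> g = \<xi>' g \<cdot>\<^bsub>X\<^esub> amap (act g) f)"

definition H1 ::
  "('g, 'e) monoid_scheme \<Rightarrow> ('o, 'm) category \<Rightarrow> ('g \<Rightarrow> ('o, 'm, 'o, 'm) functor_data) \<Rightarrow>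
     ('o \<times> ('g \<Rightarrow> 'm)) set set" where
  "H1 G X act = iso_classes (Z1 G X act)"

text \<open>In \<open>induced_iso\<close>, \<open>u\<close> is the morphism out of the coproduct of the objects \<open>g(x)\<close> with
  components \<open>\<eta>\<close> at \<open>g(x)\<close>; its target is \<open>UF(x)\<close> because \<open>F(g(x)) = F(x)\<close>.\<close>

locale G_galois_adjunction =
  G_category G X act + adjunction X Y F U \<eta> \<epsilon>
  for G :: "('g, 'e) monoid_scheme" and X :: "('o, 'm) category" and act
    and Y :: "('p, 'n) category" and F U \<eta> \<epsilon> +
  assumes F_act: "g \<in> carrier G \<Longrightarrow> functor_eq X (F \<circ>\<^sub>F act g) F"
    and G_coproducts: "has_coproducts X (carrier G)"
    and induced_iso:
      "\<lbrakk>x \<in> Ob X; is_coproduct X (carrier G) (\<lambda>g. omap (act g) x) c i;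
        u \<in> Hom X c (omap U (omap F x));
        \<And>g. g \<in> carrier G \<Longrightarrow> u \<cdot>\<^bsub>X\<^esub> i g = \<eta> (omap (act g) x)\<rbrakk>
       \<Longrightarrow> is_iso X u"
    and U_monadic: "monadic X Y F U \<eta> \<epsilon>"

section \<open>Endomorphism monoids as one-object categories\<close>

definition one_object_category :: "('m, 'e) monoid_scheme \<Rightarrow> (unit, 'm) category" where
  "one_object_category M =
     \<lparr>Ob = {()}, Arr = carrier M, Dom = (\<lambda>_. ()), Cod = (\<lambda>_. ()),
      Ident = (\<lambda>_. \<one>\<^bsub>M\<^esub>), Comp = (\<lambda>a b. a \<otimes>\<^bsub>M\<^esub> b)\<rparr>"

definition End_monoid :: "('o, 'm) category \<Rightarrow> 'o \<Rightarrow> 'm monoid" where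
  "End_monoid X x = \<lparr>carrier = Hom X x x, mult = (\<lambda>a b. a \<cdot>\<^bsub>X\<^esub> b), one = Ident X x\<rparr>"

definition Aut_group :: "('o, 'm) category \<Rightarrow> 'o \<Rightarrow> 'm monoid" where
  "Aut_group X x = units_of (End_monoid X x)"

definition twisted_action ::
  "('o, 'm) category \<Rightarrow> ('g \<Rightarrow> ('o, 'm, 'o, 'm) functor_data) \<Rightarrow> ('g \<Rightarrow> 'm) \<Rightarrow>
     'g \<Rightarrow> (unit, 'm, unit, 'm) functor_data" where
  "twisted_action X act \<xi> g =
     \<lparr>omap = (\<lambda>_. ()), amap = (\<lambda>a. \<xi> g \<cdot>\<^bsub>X\<^esub> amap (act g) a \<cdot>\<^bsub>X\<^esub> inv_arrow X (\<xi> g))\<rparr>"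

section \<open>The data attached to an object of \<open>Y\<close>\<close>

definition induced_cocycle ::
  "('g, 'e) monoid_scheme \<Rightarrow> ('o, 'm) category \<Rightarrow> ('g \<Rightarrow> ('o, 'm, 'o, 'm) functor_data) \<Rightarrow>
     ('p, 'n, 'o, 'm) functor_data \<Rightarrow> ('o \<Rightarrow> 'm) \<Rightarrow> ('p \<Rightarrow> 'n) \<Rightarrow> 'p \<Rightarrow> 'g \<Rightarrow> 'm" where
  "induced_cocycle G X act U \<eta> \<epsilon> y =
     (\<lambda>g\<in>carrier G. amap U (\<epsilon> y) \<cdot>\<^bsub>X\<^esub> \<eta> (omap (act g) (omap U y)))"

definition forms_category ::
  "('o, 'm) category \<Rightarrow> ('p, 'n) category \<Rightarrow> ('p, 'n, 'o, 'm) functor_data \<Rightarrow> 'p \<Rightarrow>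
     ('p, 'n) category" where
  "forms_category X Y U y0 = full_subcategory Y {y. isomorphic X (omap U y) (omap U y0)}"

end

theory Submission
  imports Defs
begin

text \<open>Write \<open>T = UF\<close>. As \<open>T(x)\<close> is the coproduct of the objects \<open>g(x)\<close> with injections
  \<open>\<eta>\<close> at \<open>g(x)\<close>, an arrow \<open>\<theta> : T(x) \<rightarrow> x\<close> amounts to a family \<open>\<xi>\<^sub>g = \<theta> \<eta>\<close> of arrows
  \<open>g(x) \<rightarrow> x\<close>, and \<open>\<theta>\<close> is a \<open>T\<close>-algebra iff \<open>\<xi>\<close> is a 1-cocycle; here one needs that each
  \<open>h(-)\<close>, being invertible, preserves the coproduct. By monadicity \<open>Y\<close> is therefore equivalent to
  the category of 1-cocycles in \<open>X\<close>. Cocycles can be transported along isomorphisms, so the objects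
  of \<open>Y[Y\<^sub>0]\<close> correspond, up to isomorphism, to cocycles on \<open>x\<^sub>0 = U(Y\<^sub>0)\<close> itself, and these are
  exactly the families \<open>\<phi>(g) \<xi>\<^sub>0(g)\<close> for \<open>\<phi>\<close> a 1-cocycle in the twisted monoid \<open>End(x\<^sub>0)\<close>. All
  values of such a \<open>\<phi>\<close> are invertible, which gives the comparison with \<open>Aut(x\<^sub>0)\<close>.\<close>

section \<open>Arrow calculus\<close>

text \<open>An explicit pair of mutually inverse arrows replaces \<open>is_iso\<close>. The form is
  symmetric and holds for any record \<open>C\<close>, so it also applies before a category has been
  recognised as one.\<close>

lemma isomorphic_iff:
  "isomorphic C a b \<longleftrightarrow>
    (\<exists>f\<in>Hom C a b. \<exists>g\<in>Hom C b a. g \<cdot>\<^bsub>C\<^esub> f = Ident C a \<and> f \<cdot>\<^bsub>C\<^esub> g = Ident C b)"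
  by (auto simp: isomorphic_def is_iso_def inverse_arrows_def Hom_def)

context category
begin

lemma Dom_Ob [simp]: "f \<in> Arr C \<Longrightarrow> Dom C f \<in> Ob C"
  by (rule Dom_closed)

lemma Cod_Ob [simp]: "f \<in> Arr C \<Longrightarrow> Cod C f \<in> Ob C"
  by (rule Cod_closed)

lemma Ident_simps [simp]:
  assumes "a \<in> Ob C"
  shows "Ident C a \<in> Arr C" "Dom C (Ident C a) = a" "Cod C (Ident C a) = a"
  using Id_closed[OF assms] by (auto simp: Hom_def)

text \<open>Typing is expressed through \<open>Arr\<close>, \<open>Dom\<close> and
  \<open>Cod\<close> rather than \<open>Hom\<close>: the ends of a composite are then computed by
  rewriting, with no intermediate object to guess.\<close>

lemma Comp_simps [simp]:
  assumes "f \<in> Arr C" "g \<in> Arr C" "Dom C g = Cod C f"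
  shows "g \<cdot> f \<in> Arr C" "Dom C (g \<cdot> f) = Dom C f" "Cod C (g \<cdot> f) = Cod C g"
  using Comp_closed[of f "Dom C f" "Cod C f" g "Cod C g"] assms by (auto simp: Hom_def)

lemma Comp_Ident_left [simp]: "f \<in> Arr C \<Longrightarrow> Cod C f = a \<Longrightarrow> Ident C a \<cdot> f = f"
  using Id_left[of f] by (simp add: Hom_def)

lemma Comp_Ident_right [simp]: "f \<in> Arr C \<Longrightarrow> Dom C f = a \<Longrightarrow> f \<cdot> Ident C a = f"
  using Id_right[of f] by (simp add: Hom_def)

lemma Comp_assoc_arr [simp]:
  assumes "f \<in> Arr C" "g \<in> Arr C" "h \<in> Arr C" "Dom C g = Cod C f" "Dom C h = Cod C g"
  shows "(h \<cdot> g) \<cdot> f = h \<cdot> (g \<cdot> f)"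
  using Comp_assoc[of f "Dom C f" "Cod C f" g "Cod C g" h "Cod C h"] assms
  by (simp add: Hom_def)

lemma inverse_arrows_unique:
  assumes "inverse_arrows C f g" "inverse_arrows C f g'"
  shows "g = g'"
proof -
  from assms have f: "f \<in> Hom C (Dom C f) (Cod C f)"
    and g: "g \<in> Hom C (Cod C f) (Dom C f)" "f \<cdot> g = Ident C (Cod C f)"
    and g': "g' \<in> Hom C (Cod C f) (Dom C f)" "g' \<cdot> f = Ident C (Dom C f)"
    by (auto simp: inverse_arrows_def Hom_def)
  have "g = (g' \<cdot> f) \<cdot> g" by (simp only: g' Id_left[OF g(1)])
  also have "\<dots> = g'" by (simp only: Comp_assoc[OF g(1) f g'(1)] g(2) Id_right[OF g'(1)])
  finally show ?thesis .
qed

lemma inv_arrow_eq: "inverse_arrows C f g \<Longrightarrow> inv_arrow C f = g"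
  unfolding inv_arrow_def by (blast intro: the_equality inverse_arrows_unique)

lemma inverse_arrows_inv_arrow: "is_iso C f \<Longrightarrow> inverse_arrows C f (inv_arrow C f)"
  unfolding is_iso_def using inv_arrow_eq by metis

lemma inv_arrow_simps [simp]:
  assumes "is_iso C f"
  shows "inv_arrow C f \<in> Arr C" "Dom C (inv_arrow C f) = Cod C f" "Cod C (inv_arrow C f) = Dom C f"
    "inv_arrow C f \<cdot> f = Ident C (Dom C f)" "f \<cdot> inv_arrow C f = Ident C (Cod C f)"
  using inverse_arrows_inv_arrow[OF assms] by (auto simp: inverse_arrows_def Hom_def)

lemma iso_Arr: "is_iso C f \<Longrightarrow> f \<in> Arr C"
  by (auto simp: is_iso_def inverse_arrows_def)

text \<open>Composites are normalised by nesting to the right, which hides a factor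
  \<open>inv_arrow C f \<cdot> f\<close> inside a longer product; cancellation is therefore stated
  with a tail \<open>k\<close>.\<close>

lemma inv_arrow_cancel [simp]:
  assumes "is_iso C f" "k \<in> Arr C"
  shows "Cod C k = Dom C f \<Longrightarrow> inv_arrow C f \<cdot> (f \<cdot> k) = k"
    and "Cod C k = Cod C f \<Longrightarrow> f \<cdot> (inv_arrow C f \<cdot> k) = k"
  using assms iso_Arr[OF assms(1)]
  by (simp_all flip: Comp_assoc_arr)

lemma is_isoI:
  assumes "f \<in> Hom C a b" "g \<in> Hom C b a" "g \<cdot> f = Ident C a" "f \<cdot> g = Ident C b"
  shows "is_iso C f"
  using assms by (auto simp: is_iso_def inverse_arrows_def Hom_def)

lemma is_iso_inv_arrow [simp]: "is_iso C f \<Longrightarrow> is_iso C (inv_arrow C f)"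
  using iso_Arr[of f] by (intro is_isoI[of _ "Cod C f" "Dom C f" f]) (auto simp: Hom_def)

lemma is_iso_Ident [simp]: "a \<in> Ob C \<Longrightarrow> is_iso C (Ident C a)"
  by (rule is_isoI[of _ a a "Ident C a"]) (auto simp: Hom_def)

lemma is_iso_Comp [simp]:
  assumes "is_iso C f" "is_iso C g" "Dom C g = Cod C f"
  shows "is_iso C (g \<cdot> f)"
  using assms iso_Arr[of f] iso_Arr[of g]
  by (intro is_isoI[of _ "Dom C f" "Cod C g" "inv_arrow C f \<cdot> inv_arrow C g"])
     (auto simp: Hom_def)

lemma iso_cancel_left:
  assumes "is_iso C t" "f \<in> Arr C" "g \<in> Arr C" "Cod C f = Dom C t" "Cod C g = Dom C t"
    "t \<cdot> f = t \<cdot> g"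
  shows "f = g"
  using assms by (metis inv_arrow_cancel(1))

lemma iso_cancel_right:
  assumes "is_iso C t" "f \<in> Arr C" "g \<in> Arr C" "Dom C f = Cod C t" "Dom C g = Cod C t"
    "f \<cdot> t = g \<cdot> t"
  shows "f = g"
proof -
  have "(f \<cdot> t) \<cdot> inv_arrow C t = (g \<cdot> t) \<cdot> inv_arrow C t"
    by (simp only: assms(6))
  then show ?thesis using assms(1-5) iso_Arr[OF assms(1)] by simp
qed

lemma inv_arrow_Comp:
  assumes "is_iso C f" "is_iso C g" "Dom C g = Cod C f"
  shows "inv_arrow C (g \<cdot> f) = inv_arrow C f \<cdot> inv_arrow C g"
  by (rule inv_arrow_eq)
    (use assms iso_Arr[of f] iso_Arr[of g] in \<open>auto simp: inverse_arrows_def Hom_def\<close>)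

text \<open>Inverting two opposite sides of a commuting square leaves it commuting. This is what
  makes the inverse of a natural isomorphism natural.\<close>

lemma iso_square_inverse:
  assumes "is_iso C s" "is_iso C t" "f \<in> Arr C" "g \<in> Arr C"
    and "Dom C f = Dom C t" "Cod C f = Dom C s" "Dom C g = Cod C t" "Cod C g = Cod C s"
    and eq: "s \<cdot> f = g \<cdot> t"
  shows "inv_arrow C s \<cdot> g = f \<cdot> inv_arrow C t"
proof -
  have "inv_arrow C s \<cdot> g \<cdot> t = inv_arrow C s \<cdot> (s \<cdot> f)"
    by (simp only: eq)
  then have "inv_arrow C s \<cdot> g \<cdot> t = f"
    using assms(1-8) by simp
  with assms(1-8) iso_Arr[OF assms(2)] show ?thesis
    using iso_cancel_right[of t "inv_arrow C s \<cdot> g" "f \<cdot> inv_arrow C t"] by simp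
qed

lemma isomorphic_Ob: "isomorphic C a b \<Longrightarrow> a \<in> Ob C \<and> b \<in> Ob C"
  by (auto simp: isomorphic_def Hom_def)

lemma isomorphic_refl: "a \<in> Ob C \<Longrightarrow> isomorphic C a a"
  unfolding isomorphic_def by (rule bexI[of _ "Ident C a"]) (auto simp: Hom_def)

lemma isomorphic_sym: "isomorphic C a b \<Longrightarrow> isomorphic C b a"
  unfolding isomorphic_iff by blast

lemma isomorphic_trans:
  assumes "isomorphic C a b" "isomorphic C b c"
  shows "isomorphic C a c"
proof -
  obtain f g where "f \<in> Hom C a b" "g \<in> Hom C b c" "is_iso C f" "is_iso C g"
    using assms by (auto simp: isomorphic_def)
  then show ?thesis
    unfolding isomorphic_def by (intro bexI[of _ "g \<cdot> f"]) (auto simp: Hom_def)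
qed

lemma equiv_isomorphic: "equiv (Ob C) {(a, b). a \<in> Ob C \<and> b \<in> Ob C \<and> isomorphic C a b}"
  by (rule equivI)
     (auto intro: refl_onI symI transI isomorphic_refl isomorphic_sym isomorphic_trans)

lemma category_full_subcategory: "category (full_subcategory C S)"
  by unfold_locales (auto simp: full_subcategory_def Hom_def)

end

section \<open>Functors and their composites\<close>

lemma omap_comp_functor [simp]: "omap (S \<circ>\<^sub>F T) a = omap S (omap T a)"
  and amap_comp_functor [simp]: "amap (S \<circ>\<^sub>F T) f = amap S (amap T f)"
  and omap_id_functor [simp]: "omap id_functor a = a"
  and amap_id_functor [simp]: "amap id_functor f = f"
  by (simp_all add: comp_functor_def id_functor_def)

context is_functor
begin

lemma omap_Ob [simp]: "a \<in> Ob C \<Longrightarrow> omap F a \<in> Ob D"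
  by (rule omap_closed)

lemma amap_simps [simp]:
  assumes "f \<in> Arr C"
  shows "amap F f \<in> Arr D" "Dom D (amap F f) = omap F (Dom C f)"
    "Cod D (amap F f) = omap F (Cod C f)"
  using amap_closed[of f "Dom C f" "Cod C f"] assms by (auto simp: Hom_def)

lemma amap_Ident [simp]: "a \<in> Ob C \<Longrightarrow> amap F (Ident C a) = Ident D (omap F a)"
  by (rule amap_Id)

lemma amap_Comp_arr [simp]:
  assumes "f \<in> Arr C" "g \<in> Arr C" "Dom C g = Cod C f"
  shows "amap F (g \<cdot>\<^bsub>C\<^esub> f) = amap F g \<cdot>\<^bsub>D\<^esub> amap F f"
  using amap_Comp[of f "Dom C f" "Cod C f" g "Cod C g"] assms by (simp add: Hom_def)

lemma amap_inverse_arrows: "inverse_arrows C f g \<Longrightarrow> inverse_arrows D (amap F f) (amap F g)"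
  by (auto simp: inverse_arrows_def Hom_def simp flip: amap_Comp_arr)

lemma amap_is_iso [simp]: "is_iso C f \<Longrightarrow> is_iso D (amap F f)"
  unfolding is_iso_def using amap_inverse_arrows by blast

lemma amap_inv_arrow: "is_iso C f \<Longrightarrow> amap F (inv_arrow C f) = inv_arrow D (amap F f)"
  by (metis D.inv_arrow_eq C.inverse_arrows_inv_arrow amap_inverse_arrows)

lemma omap_isomorphic: "isomorphic C a b \<Longrightarrow> isomorphic D (omap F a) (omap F b)"
  unfolding isomorphic_def using amap_closed amap_is_iso by blast

end

lemma (in category) is_functor_id: "is_functor C C id_functor"
  by unfold_locales auto

lemma is_functor_comp:
  assumes "is_functor B C S" "is_functor C D T"
  shows "is_functor B D (T \<circ>\<^sub>F S)"
proof -
  interpret S: is_functor B C S by fact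
  interpret T: is_functor C D T by fact
  show ?thesis by unfold_locales (auto simp: Hom_def)
qed

section \<open>Fully faithful functors and equivalences\<close>

definition fully_faithful ::
  "('o, 'm) category \<Rightarrow> ('p, 'n) category \<Rightarrow> ('o, 'm, 'p, 'n) functor_data \<Rightarrow> bool" where
  "fully_faithful C D S \<longleftrightarrow>
     (\<forall>a\<in>Ob C. \<forall>b\<in>Ob C. bij_betw (amap S) (Hom C a b) (Hom D (omap S a) (omap S b)))"

definition essentially_surjective ::
  "('o, 'm) category \<Rightarrow> ('p, 'n) category \<Rightarrow> ('o, 'm, 'p, 'n) functor_data \<Rightarrow> bool" where
  "essentially_surjective C D S \<longleftrightarrow> (\<forall>d\<in>Ob D. \<exists>c\<in>Ob C. isomorphic D (omap S c) d)"

lemma fully_faithful_comp: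
  assumes "is_functor B C S" "fully_faithful B C S" "fully_faithful C D T"
  shows "fully_faithful B D (T \<circ>\<^sub>F S)"
proof -
  interpret S: is_functor B C S by fact
  have amap_eq: "amap (T \<circ>\<^sub>F S) = amap T \<circ> amap S"
    by auto
  show ?thesis
    unfolding fully_faithful_def amap_eq omap_comp_functor
  proof (intro ballI)
    fix a b assume ab: "a \<in> Ob B" "b \<in> Ob B"
    then have "bij_betw (amap S) (Hom B a b) (Hom C (omap S a) (omap S b))"
      and "bij_betw (amap T) (Hom C (omap S a) (omap S b))
        (Hom D (omap T (omap S a)) (omap T (omap S b)))"
      using assms(2,3) S.omap_closed unfolding fully_faithful_def by auto
    then show "bij_betw (amap T \<circ> amap S) (Hom B a b)
        (Hom D (omap T (omap S a)) (omap T (omap S b)))"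
      by (rule bij_betw_trans)
  qed
qed

lemma fully_faithful_inj:
  assumes "fully_faithful C D S" "a \<in> Ob C" "b \<in> Ob C" "f \<in> Hom C a b" "g \<in> Hom C a b"
    "amap S f = amap S g"
  shows "f = g"
  using assms unfolding fully_faithful_def bij_betw_def inj_on_def by blast

lemma fully_faithful_surj:
  assumes "fully_faithful C D S" "a \<in> Ob C" "b \<in> Ob C" "h \<in> Hom D (omap S a) (omap S b)"
  obtains f where "f \<in> Hom C a b" "amap S f = h"
proof -
  have "h \<in> amap S ` Hom C a b"
    using assms unfolding fully_faithful_def bij_betw_def by simp
  then show thesis using that by blast
qed

text \<open>Fullness lifts the inverse of the image to an arrow \<open>g\<close>, and faithfulness
  lifts the two equations saying that \<open>g\<close> is inverse to \<open>f\<close>.\<close>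

lemma fully_faithful_reflects_iso:
  assumes "is_functor C D S" "fully_faithful C D S" "f \<in> Arr C" "is_iso D (amap S f)"
  shows "is_iso C f"
proof -
  interpret S: is_functor C D S by fact
  have "inv_arrow D (amap S f) \<in> Hom D (omap S (Cod C f)) (omap S (Dom C f))"
    using assms by (simp add: Hom_def)
  then obtain g where g: "g \<in> Hom C (Cod C f) (Dom C f)" "amap S g = inv_arrow D (amap S f)"
    using assms by (meson S.C.Dom_Ob S.C.Cod_Ob fully_faithful_surj)
  have "g \<cdot>\<^bsub>C\<^esub> f = Ident C (Dom C f)"
    by (rule fully_faithful_inj[OF assms(2), of "Dom C f" "Dom C f"]) (use g assms in \<open>auto simp: Hom_def\<close>)
  moreover have "f \<cdot>\<^bsub>C\<^esub> g = Ident C (Cod C f)"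
    by (rule fully_faithful_inj[OF assms(2), of "Cod C f" "Cod C f"]) (use g assms in \<open>auto simp: Hom_def\<close>)
  ultimately show ?thesis
    using g assms(3) by (intro S.C.is_isoI[of f _ _ g]) (auto simp: Hom_def)
qed

lemma fully_faithful_isomorphic_iff:
  assumes "is_functor C D S" "fully_faithful C D S" "a \<in> Ob C" "b \<in> Ob C"
  shows "isomorphic D (omap S a) (omap S b) \<longleftrightarrow> isomorphic C a b"
proof
  assume "isomorphic D (omap S a) (omap S b)"
  then obtain h where "h \<in> Hom D (omap S a) (omap S b)" "is_iso D h"
    by (auto simp: isomorphic_def)
  moreover then obtain f where "f \<in> Hom C a b" "amap S f = h"
    using fully_faithful_surj[OF assms(2-4)] by blast
  ultimately show "isomorphic C a b"
    using fully_faithful_reflects_iso[OF assms(1,2), of f]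
    by (auto simp: isomorphic_def Hom_def)
next
  interpret S: is_functor C D S by fact
  show "isomorphic D (omap S a) (omap S b)" if "isomorphic C a b"
    using that by (rule S.omap_isomorphic)
qed

lemma essentially_surjective_comp:
  assumes "is_functor C D T" "essentially_surjective B C S" "essentially_surjective C D T"
  shows "essentially_surjective B D (T \<circ>\<^sub>F S)"
  unfolding essentially_surjective_def
proof
  interpret T: is_functor C D T by fact
  fix d assume "d \<in> Ob D"
  then obtain c where c: "c \<in> Ob C" "isomorphic D (omap T c) d"
    using assms(3) unfolding essentially_surjective_def by blast
  then obtain b where b: "b \<in> Ob B" "isomorphic C (omap S b) c"
    using assms(2) unfolding essentially_surjective_def by blast
  then show "\<exists>b\<in>Ob B. isomorphic D (omap (T \<circ>\<^sub>F S) b) d"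
    using c T.omap_isomorphic T.D.isomorphic_trans by (metis omap_comp_functor)
qed

section \<open>Natural isomorphisms and equivalences\<close>

context natural_transformation
begin

lemma component_simps [simp]:
  assumes "a \<in> Ob C"
  shows "\<tau> a \<in> Arr D" "Dom D (\<tau> a) = omap S a" "Cod D (\<tau> a) = omap T a"
  using component[OF assms] by (auto simp: Hom_def)

lemma naturality_arr:
  "f \<in> Arr C \<Longrightarrow> \<tau> (Cod C f) \<cdot>\<^bsub>D\<^esub> amap S f = amap T f \<cdot>\<^bsub>D\<^esub> \<tau> (Dom C f)"
  by (rule naturality) (simp add: Hom_def)

end

lemma natural_isomorphism_inverse:
  assumes "natural_isomorphism C D S T \<tau>"
  shows "natural_isomorphism C D T S (\<lambda>a. inv_arrow D (\<tau> a))"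
proof -
  interpret natural_isomorphism C D S T \<tau> by fact
  note component_iso[simp]
  show ?thesis
  proof unfold_locales
    fix f a b assume f: "f \<in> Hom C a b"
    then have ab: "a \<in> Ob C" "b \<in> Ob C" by (auto simp: Hom_def)
    show "inv_arrow D (\<tau> b) \<cdot>\<^bsub>D\<^esub> amap T f = amap S f \<cdot>\<^bsub>D\<^esub> inv_arrow D (\<tau> a)"
      by (rule S.D.iso_square_inverse) (use f ab naturality[OF f] in \<open>auto simp: Hom_def\<close>)
  qed (auto simp: Hom_def)
qed

text \<open>Naturality of \<alpha> expresses \<open>f\<close> as the conjugate of
  \<open>T(S(f))\<close> by components of \<alpha>, so \<open>S(f)\<close> determines
  \<open>f\<close>.\<close>

lemma faithful_of_iso_id:
  assumes "natural_isomorphism C C id_functor (T \<circ>\<^sub>F S) \<alpha>"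
    and "f \<in> Hom C a b" "g \<in> Hom C a b" "amap S f = amap S g"
  shows "f = g"
proof -
  interpret natural_isomorphism C C id_functor "T \<circ>\<^sub>F S" \<alpha> by fact
  have "a \<in> Ob C" "b \<in> Ob C" using assms(2) by (auto simp: Hom_def)
  note ab = this
  show ?thesis
    by (rule S.C.iso_cancel_left[of "\<alpha> b"])
      (use ab naturality[OF assms(2)] naturality[OF assms(3)] assms(2-4) component_iso[of b] in \<open>auto simp: Hom_def\<close>)
qed

text \<open>Faithfulness comes from \<alpha>, essential surjectivity from the components of \<beta>.
  Fullness uses both: \<alpha> provides a preimage and \<beta> makes the quasi-inverse
  \<open>T\<close> faithful.\<close>

lemma equivalence_fully_faithful_essentially_surjective:
  assumes "is_equivalence C D S"
  shows "fully_faithful C D S" "essentially_surjective C D S"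
proof -
  obtain T \<alpha> \<beta> where S: "is_functor C D S" and T: "is_functor D C T"
    and \<alpha>: "natural_isomorphism C C id_functor (T \<circ>\<^sub>F S) \<alpha>"
    and \<beta>: "natural_isomorphism D D (S \<circ>\<^sub>F T) id_functor \<beta>"
    using assms unfolding is_equivalence_def by blast
  interpret S: is_functor C D S by fact
  interpret T: is_functor D C T by fact
  interpret \<alpha>: natural_isomorphism C C id_functor "T \<circ>\<^sub>F S" \<alpha> by fact
  interpret \<beta>: natural_isomorphism D D "S \<circ>\<^sub>F T" id_functor \<beta> by fact
  note \<alpha>.component_iso[simp] \<beta>.component_iso[simp]
  show "fully_faithful C D S"
    unfolding fully_faithful_def
  proof (intro ballI)
    fix a b assume ab: "a \<in> Ob C" "b \<in> Ob C"
    have "h \<in> amap S ` Hom C a b" if h: "h \<in> Hom D (omap S a) (omap S b)" for h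
    proof
      \<comment> \<open>Naturality of \<alpha> leaves no other candidate: \<open>S(f) = h\<close>
        forces \<open>\<alpha> b \<cdot> f = T(h) \<cdot> \<alpha> a\<close>.\<close>
      define f where "f = inv_arrow C (\<alpha> b) \<cdot>\<^bsub>C\<^esub> amap T h \<cdot>\<^bsub>C\<^esub> \<alpha> a"
      show f: "f \<in> Hom C a b"
        unfolding f_def using h ab by (auto simp: Hom_def)
      have eq: "amap T (amap S f) \<cdot>\<^bsub>C\<^esub> \<alpha> a = amap T h \<cdot>\<^bsub>C\<^esub> \<alpha> a"
        using \<alpha>.naturality[OF f, symmetric] h ab by (simp add: f_def Hom_def)
      have "amap T (amap S f) = amap T h"
        by (rule S.C.iso_cancel_right[of "\<alpha> a"]) (use eq h f ab in \<open>auto simp: Hom_def\<close>)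
      \<comment> \<open>Here \<open>T\<close> is faithful, by the same argument with \<alpha>
        replaced by the inverse of \<beta>.\<close>
      then show "h = amap S f"
        using S.amap_closed[OF f] h
        by (intro faithful_of_iso_id[OF natural_isomorphism_inverse[OF \<beta>]]) auto
    qed
    then show "bij_betw (amap S) (Hom C a b) (Hom D (omap S a) (omap S b))"
      using S.amap_closed faithful_of_iso_id[OF \<alpha>] unfolding bij_betw_def inj_on_def by blast
  qed
  show "essentially_surjective C D S"
    unfolding essentially_surjective_def isomorphic_def
  proof
    fix d assume "d \<in> Ob D"
    then show "\<exists>c\<in>Ob C. \<exists>f\<in>Hom D (omap S c) d. is_iso D f"
      by (intro bexI[of _ "omap T d"] bexI[of _ "\<beta> d"]) (auto simp: Hom_def)
  qed
qed

text \<open>For each \<open>c\<close>, an object \<open>s c\<close> and an isomorphism from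
  \<open>L(c)\<close> to \<open>P(s c)\<close> are chosen. Conjugating \<open>L(f)\<close> by these
  isomorphisms and lifting along \<open>P\<close> gives the action on arrows; functoriality follows
  from faithfulness of \<open>P\<close>.\<close>

lemma lift_through_fully_faithful:
  fixes L :: "('o, 'm, 'q, 'k) functor_data" and P :: "('p, 'n, 'q, 'k) functor_data"
  assumes L: "is_functor C Z L" and P: "is_functor D Z P" and ff: "fully_faithful D Z P"
    and img: "\<And>c. c \<in> Ob C \<Longrightarrow> \<exists>d\<in>Ob D. isomorphic Z (omap L c) (omap P d)"
  obtains S \<tau> where "is_functor C D S" "natural_isomorphism C Z L (P \<circ>\<^sub>F S) \<tau>"
proof -
  interpret L: is_functor C Z L by fact
  interpret P: is_functor D Z P by fact
  have "\<forall>c\<in>Ob C. \<exists>d t. d \<in> Ob D \<and> t \<in> Hom Z (omap L c) (omap P d) \<and> is_iso Z t"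
    using img by (meson isomorphic_def)
  then obtain s \<tau> where "\<And>c. c \<in> Ob C \<Longrightarrow> s c \<in> Ob D"
    and "\<And>c. c \<in> Ob C \<Longrightarrow> \<tau> c \<in> Hom Z (omap L c) (omap P (s c))"
    and "\<And>c. c \<in> Ob C \<Longrightarrow> is_iso Z (\<tau> c)"
    by metis
  then have s [simp]: "s c \<in> Ob D" and \<tau> [simp]: "is_iso Z (\<tau> c)" "\<tau> c \<in> Arr Z"
    "Dom Z (\<tau> c) = omap L c" "Cod Z (\<tau> c) = omap P (s c)" if "c \<in> Ob C" for c
    using that by (auto simp: Hom_def)
  define conj where "conj f = \<tau> (Cod C f) \<cdot>\<^bsub>Z\<^esub> amap L f \<cdot>\<^bsub>Z\<^esub> inv_arrow Z (\<tau> (Dom C f))" for f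
  \<comment> \<open>The choice of \<open>k\<close> is harmless: on arrows of \<open>C\<close> it
    exists by fullness of \<open>P\<close> and is unique by faithfulness.\<close>
  define S where "S = \<lparr>omap = s,
    amap = (\<lambda>f. SOME k. k \<in> Hom D (s (Dom C f)) (s (Cod C f)) \<and> amap P k = conj f)\<rparr>"
  have omap_S [simp]: "omap S = s"
    by (simp add: S_def)
  have S: "amap S f \<in> Hom D (s a) (s b)" and PS: "amap P (amap S f) = conj f"
    if f: "f \<in> Hom C a b" for f a b
  proof -
    have "conj f \<in> Hom Z (omap P (s a)) (omap P (s b))"
      using f by (auto simp: conj_def Hom_def)
    then have "\<exists>k. k \<in> Hom D (s (Dom C f)) (s (Cod C f)) \<and> amap P k = conj f"
      using fully_faithful_surj[OF ff, of "s a" "s b" "conj f"] f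
      by (simp add: Hom_def) (metis L.C.Dom_Ob L.C.Cod_Ob s)
    from someI_ex[OF this] show "amap S f \<in> Hom D (s a) (s b)" "amap P (amap S f) = conj f"
      using f by (auto simp: S_def Hom_def)
  qed
  have "is_functor C D S"
  proof unfold_locales
    fix a assume a: "a \<in> Ob C"
    show "amap S (Ident C a) = Ident D (omap S a)"
      by (rule fully_faithful_inj[OF ff, of "s a" "s a"])
      (use a S[OF L.C.Id_closed[OF a]] PS[OF L.C.Id_closed[OF a]] in \<open>auto simp: conj_def Hom_def\<close>)
  next
    fix f a b g c assume fg: "f \<in> Hom C a b" "g \<in> Hom C b c"
    then have gf: "g \<cdot>\<^bsub>C\<^esub> f \<in> Hom C a c" and obs: "a \<in> Ob C" "b \<in> Ob C" "c \<in> Ob C"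
      by (auto simp: Hom_def)
    \<comment> \<open>After applying \<open>P\<close> both sides become conjugates, and the
      isomorphism chosen at the middle object \<open>b\<close> cancels against its inverse.\<close>
    show "amap S (g \<cdot>\<^bsub>C\<^esub> f) = amap S g \<cdot>\<^bsub>D\<^esub> amap S f"
    proof (rule fully_faithful_inj[OF ff, of "s a" "s c"])
      show "amap P (amap S (g \<cdot>\<^bsub>C\<^esub> f)) = amap P (amap S g \<cdot>\<^bsub>D\<^esub> amap S f)"
        unfolding PS[OF gf] P.amap_Comp[OF S[OF fg(1)] S[OF fg(2)]] PS[OF fg(1)] PS[OF fg(2)]
        using fg obs by (auto simp: conj_def Hom_def)
    qed (use obs S[OF fg(1)] S[OF fg(2)] S[OF gf] P.C.Comp_closed in auto)
  qed (use S in auto)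
  then interpret S: is_functor C D S .
  interpret PS: is_functor C Z "P \<circ>\<^sub>F S"
    using is_functor_comp S.is_functor_axioms P by blast
  have "natural_isomorphism C Z L (P \<circ>\<^sub>F S) \<tau>"
  proof unfold_locales
    fix f a b assume "f \<in> Hom C a b"
    then show "\<tau> b \<cdot>\<^bsub>Z\<^esub> amap L f = amap (P \<circ>\<^sub>F S) f \<cdot>\<^bsub>Z\<^esub> \<tau> a"
      using PS by (auto simp: conj_def Hom_def)
  qed (auto simp: Hom_def)
  then show thesis using that S.is_functor_axioms by blast
qed

text \<open>Being fully faithful passes from \<open>L\<close> to the isomorphic composite of
  \<open>S\<close> and \<open>P\<close>, and a fully faithful \<open>P\<close> can then be
  cancelled.\<close>

lemma fully_faithful_iso_comp:
  assumes "is_functor C D S" "is_functor D Z P" "fully_faithful D Z P"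
    and "fully_faithful C Z L" "natural_isomorphism C Z L (P \<circ>\<^sub>F S) \<tau>"
  shows "fully_faithful C D S"
  unfolding fully_faithful_def
proof (intro ballI)
  interpret S: is_functor C D S by fact
  interpret P: is_functor D Z P by fact
  interpret \<tau>: natural_isomorphism C Z L "P \<circ>\<^sub>F S" \<tau> by fact
  note \<tau>.component_iso[simp]
  fix a b assume ab: "a \<in> Ob C" "b \<in> Ob C"
  have "f = g" if fg: "f \<in> Hom C a b" "g \<in> Hom C a b" and eq: "amap S f = amap S g" for f g
  proof (rule fully_faithful_inj[OF assms(4) ab fg])
    show "amap L f = amap L g"
      by (rule P.D.iso_cancel_left[of "\<tau> b"])
      (use \<tau>.naturality[OF fg(1)] \<tau>.naturality[OF fg(2)] eq fg ab in \<open>auto simp: Hom_def\<close>)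
  qed
  moreover have "h \<in> amap S ` Hom C a b" if h: "h \<in> Hom D (omap S a) (omap S b)" for h
  proof -
    have "inv_arrow Z (\<tau> b) \<cdot>\<^bsub>Z\<^esub> amap P h \<cdot>\<^bsub>Z\<^esub> \<tau> a \<in> Hom Z (omap L a) (omap L b)"
      using h ab by (auto simp: Hom_def)
    then obtain f where f: "f \<in> Hom C a b"
      "amap L f = inv_arrow Z (\<tau> b) \<cdot>\<^bsub>Z\<^esub> amap P h \<cdot>\<^bsub>Z\<^esub> \<tau> a"
      by (rule fully_faithful_surj[OF assms(4) ab])
    have eq: "amap P (amap S f) \<cdot>\<^bsub>Z\<^esub> \<tau> a = amap P h \<cdot>\<^bsub>Z\<^esub> \<tau> a"
      using \<tau>.naturality[OF f(1)] h ab by (auto simp: f(2) Hom_def)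
    have PSf: "amap P (amap S f) = amap P h"
      by (rule P.D.iso_cancel_right[of "\<tau> a"]) (use eq h f(1) ab in \<open>auto simp: Hom_def\<close>)
    have "amap S f = h"
      by (rule fully_faithful_inj[OF assms(3) _ _ S.amap_closed[OF f(1)] h PSf]) (use ab in auto)
    then show ?thesis using f(1) by blast
  qed
  ultimately show "bij_betw (amap S) (Hom C a b) (Hom D (omap S a) (omap S b))"
    using S.amap_closed unfolding bij_betw_def inj_on_def by blast
qed

text \<open>The quasi-inverse \<open>T\<close> is the identity functor of \<open>D\<close> lifted
  through \<open>S\<close>. The lift brings its own natural isomorphism \<tau> from the identity of
  \<open>D\<close> to the composite of \<open>T\<close> and \<open>S\<close>; the one on
  \<open>C\<close> is pulled back from \<tau>.\<close>

lemma is_equivalenceI: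
  assumes S: "is_functor C D S" and ff: "fully_faithful C D S"
    and eso: "essentially_surjective C D S"
  shows "is_equivalence C D S"
proof -
  interpret S: is_functor C D S by fact
  obtain T \<tau> where T: "is_functor D C T"
    and \<tau>: "natural_isomorphism D D id_functor (S \<circ>\<^sub>F T) \<tau>"
  proof (rule lift_through_fully_faithful[OF S.D.is_functor_id S ff])
    fix d assume "d \<in> Ob D"
    then show "\<exists>c\<in>Ob C. isomorphic D (omap id_functor d) (omap S c)"
      using eso S.D.isomorphic_sym unfolding essentially_surjective_def by fastforce
  qed
  interpret T: is_functor D C T by fact
  interpret TS: is_functor C C "T \<circ>\<^sub>F S" by (rule is_functor_comp[OF S T])
  interpret STS: is_functor C D "S \<circ>\<^sub>F T \<circ>\<^sub>F S"
    by (intro is_functor_comp[OF _ S] is_functor_comp[OF S T])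
  interpret \<tau>: natural_isomorphism D D id_functor "S \<circ>\<^sub>F T" \<tau> by fact
  note \<tau>.component_iso[simp]
  \<comment> \<open>The component of \<alpha> at \<open>c\<close> is the preimage under
    \<open>S\<close> of the component of \<tau> at \<open>S(c)\<close>; it is invertible because
    \<open>S\<close> reflects isomorphisms, and natural because \<open>S\<close> is
    faithful.\<close>
  have "\<forall>c\<in>Ob C. \<exists>a. a \<in> Hom C c (omap T (omap S c)) \<and> amap S a = \<tau> (omap S c)"
  proof
    fix c assume "c \<in> Ob C"
    then have "\<tau> (omap S c) \<in> Hom D (omap S c) (omap S (omap T (omap S c)))"
      by (simp add: Hom_def)
    then show "\<exists>a. a \<in> Hom C c (omap T (omap S c)) \<and> amap S a = \<tau> (omap S c)"
      using \<open>c \<in> Ob C\<close> fully_faithful_surj[OF ff, of c "omap T (omap S c)" "\<tau> (omap S c)"]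
      by (metis S.omap_Ob T.omap_Ob)
  qed
  then obtain \<alpha> where "\<And>c. c \<in> Ob C \<Longrightarrow> \<alpha> c \<in> Hom C c (omap T (omap S c))"
    and S\<alpha>: "\<And>c. c \<in> Ob C \<Longrightarrow> amap S (\<alpha> c) = \<tau> (omap S c)"
    by metis
  then have \<alpha> [simp]: "\<alpha> c \<in> Arr C" "Dom C (\<alpha> c) = c" "Cod C (\<alpha> c) = omap T (omap S c)"
    if "c \<in> Ob C" for c
    using that by (auto simp: Hom_def)
  interpret I: is_functor C C id_functor by (rule S.C.is_functor_id)
  have "natural_isomorphism C C id_functor (T \<circ>\<^sub>F S) \<alpha>"
  proof unfold_locales
    fix c assume "c \<in> Ob C"
    then show "is_iso C (\<alpha> c)"
      using fully_faithful_reflects_iso[OF S ff, of "\<alpha> c"] S\<alpha> by simp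
  next
    fix f a b assume f: "f \<in> Hom C a b"
    then have ab: "a \<in> Ob C" "b \<in> Ob C" by (auto simp: Hom_def)
    show "\<alpha> b \<cdot>\<^bsub>C\<^esub> amap id_functor f = amap (T \<circ>\<^sub>F S) f \<cdot>\<^bsub>C\<^esub> \<alpha> a"
      by (rule fully_faithful_inj[OF ff, of a "omap T (omap S b)"])
        (use f ab \<tau>.naturality[OF S.amap_closed[OF f]] in \<open>auto simp: Hom_def S\<alpha>\<close>)
  qed (auto simp: Hom_def)
  then show ?thesis
    unfolding is_equivalence_def using S T natural_isomorphism_inverse[OF \<tau>] by blast
qed

text \<open>Lifting \<open>L\<close> through \<open>P\<close> gives a functor from \<open>C\<close>
  to \<open>D\<close>, so none has to be written down by hand. It will be applied with
  \<open>Z\<close> the category of 1-cocycles in \<open>X\<close>, into which both sides of the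
  desired equivalence embed.\<close>

lemma equivalence_of_same_essential_image:
  assumes L: "is_functor C Z L" "fully_faithful C Z L" and P: "is_functor D Z P" "fully_faithful D Z P"
    and img: "\<And>c. c \<in> Ob C \<Longrightarrow> \<exists>d\<in>Ob D. isomorphic Z (omap L c) (omap P d)"
    and img': "\<And>d. d \<in> Ob D \<Longrightarrow> \<exists>c\<in>Ob C. isomorphic Z (omap L c) (omap P d)"
  shows "equivalent_categories C D"
proof -
  interpret L: is_functor C Z L by (rule L)
  obtain S \<tau> where S: "is_functor C D S" and \<tau>: "natural_isomorphism C Z L (P \<circ>\<^sub>F S) \<tau>"
    using lift_through_fully_faithful[OF L(1) P img] by blast
  interpret S: is_functor C D S by (rule S)
  interpret \<tau>: natural_isomorphism C Z L "P \<circ>\<^sub>F S" \<tau> by (rule \<tau>)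
  have "essentially_surjective C D S"
    unfolding essentially_surjective_def
  proof
    fix d assume d: "d \<in> Ob D"
    then obtain c where c: "c \<in> Ob C" "isomorphic Z (omap L c) (omap P d)"
      using img' by blast
    moreover have "isomorphic Z (omap L c) (omap P (omap S c))"
      unfolding isomorphic_def using c(1) \<tau>.component_iso
      by (intro bexI[of _ "\<tau> c"]) (auto simp: Hom_def)
    ultimately have "isomorphic Z (omap P (omap S c)) (omap P d)"
      using L.D.isomorphic_sym L.D.isomorphic_trans by blast
    then show "\<exists>c\<in>Ob C. isomorphic D (omap S c) d"
      using c(1) d fully_faithful_isomorphic_iff[OF P] by (metis S.omap_closed)
  qed
  then show ?thesis
    unfolding equivalent_categories_def
    using is_equivalenceI[OF S fully_faithful_iso_comp[OF S P L(2) \<tau>]] by blast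
qed

section \<open>Full subcategories and sets of isomorphism classes\<close>

lemma full_subcategory_inclusion:
  assumes "category C"
  shows "is_functor (full_subcategory C S) C id_functor"
    and "fully_faithful (full_subcategory C S) C id_functor"
proof -
  interpret category C by fact
  interpret S: category "full_subcategory C S" by (rule category_full_subcategory)
  have Hom: "Hom (full_subcategory C S) a b = Hom C a b" if "a \<in> S" "b \<in> S" for a b
    using that by (auto simp: full_subcategory_def Hom_def)
  show "is_functor (full_subcategory C S) C id_functor"
    by unfold_locales (auto simp: full_subcategory_def Hom_def)
  show "fully_faithful (full_subcategory C S) C id_functor"
    unfolding fully_faithful_def
  proof (intro ballI)
    fix a b assume "a \<in> Ob (full_subcategory C S)" "b \<in> Ob (full_subcategory C S)"
    then have "a \<in> S" "b \<in> S" by (simp_all add: full_subcategory_def)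
    then show "bij_betw (amap id_functor) (Hom (full_subcategory C S) a b)
        (Hom C (omap id_functor a) (omap id_functor b))"
      by (simp add: Hom bij_betw_def inj_on_def)
  qed
qed

text \<open>A class is sent to the saturation of its image, which avoids picking representatives.
  The equivalence \<open>iff\<close> gives well-definedness and injectivity; \<open>surj\<close> is
  needed only up to \<open>R'\<close>.\<close>

lemma bij_betw_quotient:
  assumes R: "equiv A R" and R': "equiv B R'" and f: "f \<in> A \<rightarrow> B"
    and iff: "\<And>x y. x \<in> A \<Longrightarrow> y \<in> A \<Longrightarrow> (f x, f y) \<in> R' \<longleftrightarrow> (x, y) \<in> R"
    and surj: "\<And>b. b \<in> B \<Longrightarrow> \<exists>a\<in>A. (f a, b) \<in> R'"
  shows "bij_betw (\<lambda>K. R' `` (f ` K)) (A // R) (B // R')"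
proof -
  have im: "R' `` (f ` (R `` {a})) = R' `` {f a}" if a: "a \<in> A" for a
  proof -
    have "R' `` {f b} = R' `` {f a}" if "(a, b) \<in> R" for b
    proof -
      have "b \<in> A" using that R equiv_class_eq_iff by metis
      then show ?thesis using iff[OF a] that equiv_class_eq[OF R'] by metis
    qed
    moreover have "a \<in> R `` {a}" using R a by (rule equiv_class_self)
    ultimately show ?thesis by blast
  qed
  show ?thesis
  proof (rule bij_betw_imageI, rule inj_onI)
    fix K L assume "K \<in> A // R" "L \<in> A // R" and eq: "R' `` (f ` K) = R' `` (f ` L)"
    then obtain a b where ab: "a \<in> A" "b \<in> A" "K = R `` {a}" "L = R `` {b}"
      by (auto elim!: quotientE)
    then have "(f a, f b) \<in> R'"
      using eq im R' f eq_equiv_class by (metis funcset_mem)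
    then show "K = L" using iff ab equiv_class_eq[OF R] by metis
  next
    show "(\<lambda>K. R' `` (f ` K)) ` (A // R) = B // R'"
    proof (intro subset_antisym subsetI)
      fix M assume "M \<in> (\<lambda>K. R' `` (f ` K)) ` (A // R)"
      then obtain a where "a \<in> A" "M = R' `` {f a}" using im by (auto elim!: quotientE)
      then show "M \<in> B // R'" using f by (auto intro: quotientI)
    next
      fix M assume "M \<in> B // R'"
      then obtain b where b: "b \<in> B" "M = R' `` {b}" by (auto elim!: quotientE)
      then obtain a where a: "a \<in> A" "(f a, b) \<in> R'" using surj by blast
      then have "M = R' `` (f ` (R `` {a}))" using b equiv_class_eq[OF R'] im by metis
      then show "M \<in> (\<lambda>K. R' `` (f ` K)) ` (A // R)" using a by (auto intro: quotientI)
    qed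
  qed
qed

lemma equivalent_categories_iso_classes:
  assumes "equivalent_categories C D"
  shows "\<exists>b. bij_betw b (iso_classes C) (iso_classes D)"
proof -
  obtain S where S: "is_equivalence C D S"
    using assms unfolding equivalent_categories_def by blast
  then interpret S: is_functor C D S by (simp add: is_equivalence_def)
  note ff = equivalence_fully_faithful_essentially_surjective[OF S]
  show ?thesis
    unfolding iso_classes_def
  proof (rule exI, rule bij_betw_quotient[OF S.C.equiv_isomorphic S.D.equiv_isomorphic])
    show "omap S \<in> Ob C \<rightarrow> Ob D" by simp
  next
    fix d assume "d \<in> Ob D"
    then show "\<exists>c\<in>Ob C. (omap S c, d) \<in> {(a, b). a \<in> Ob D \<and> b \<in> Ob D \<and> isomorphic D a b}"
      using ff(2) by (auto simp: essentially_surjective_def)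
  qed (simp add: fully_faithful_isomorphic_iff[OF S.is_functor_axioms ff(1)])
qed

section \<open>Coproducts\<close>

lemma is_coproduct_universal:
  assumes "is_coproduct C I A c i" "d \<in> Ob C" "\<And>k. k \<in> I \<Longrightarrow> j k \<in> Hom C (A k) d"
  shows "\<exists>!u. u \<in> Hom C c d \<and> (\<forall>k\<in>I. u \<cdot>\<^bsub>C\<^esub> i k = j k)"
  using assms by (simp add: is_coproduct_def)

text \<open>For a competing cocone, the mediating arrow out of \<open>d\<close> is the one out of
  \<open>c\<close> precomposed with the inverse of \<open>u\<close>. This turns condition (ii) of a
  Galois adjunction into a universal property of \<open>UF(x)\<close> itself.\<close>

lemma is_coproduct_iso:
  assumes "category C" and cop: "is_coproduct C I A c i" and u: "u \<in> Hom C c d" "is_iso C u"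
    and j: "\<And>k. k \<in> I \<Longrightarrow> u \<cdot>\<^bsub>C\<^esub> i k = j k"
  shows "is_coproduct C I A d j"
proof -
  interpret category C by fact
  let ?u = "inv_arrow C u"
  have [simp]: "u \<in> Arr C" "Dom C u = c" "Cod C u = d" "is_iso C u" "d \<in> Ob C"
    using u by (auto simp: Hom_def)
  have i: "\<And>k. k \<in> I \<Longrightarrow> i k \<in> Hom C (A k) c"
    using cop by (simp add: is_coproduct_def)
  have [simp]: "i k \<in> Arr C" "Dom C (i k) = A k" "Cod C (i k) = c" if "k \<in> I" for k
    using i[OF that] by (auto simp: Hom_def)
  show ?thesis
    unfolding is_coproduct_def
  proof (intro conjI ballI allI impI)
    show "d \<in> Ob C" by simp
    show "j k \<in> Hom C (A k) d" if "k \<in> I" for k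
      unfolding j[OF that, symmetric] by (rule Comp_closed[OF i[OF that] u(1)])
    fix e l assume e: "e \<in> Ob C" and l: "\<forall>k\<in>I. l k \<in> Hom C (A k) e"
    from is_coproduct_universal[OF cop e] l obtain v where v: "v \<in> Hom C c e" "\<And>k. k \<in> I \<Longrightarrow> v \<cdot>\<^bsub>C\<^esub> i k = l k"
      and uniq: "\<And>w. \<lbrakk>w \<in> Hom C c e; \<And>k. k \<in> I \<Longrightarrow> w \<cdot>\<^bsub>C\<^esub> i k = l k\<rbrakk> \<Longrightarrow> w = v"
      by metis
    show "\<exists>!w. w \<in> Hom C d e \<and> (\<forall>k\<in>I. w \<cdot>\<^bsub>C\<^esub> j k = l k)"
    proof (rule ex1I[of _ "v \<cdot>\<^bsub>C\<^esub> ?u"])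
      show "v \<cdot>\<^bsub>C\<^esub> ?u \<in> Hom C d e \<and> (\<forall>k\<in>I. (v \<cdot>\<^bsub>C\<^esub> ?u) \<cdot>\<^bsub>C\<^esub> j k = l k)"
        using v by (auto simp: Hom_def simp flip: j)
    next
      fix w assume w: "w \<in> Hom C d e \<and> (\<forall>k\<in>I. w \<cdot>\<^bsub>C\<^esub> j k = l k)"
      then have "w \<cdot>\<^bsub>C\<^esub> u = v"
        by (intro uniq) (auto simp: Hom_def j)
      then show "w = v \<cdot>\<^bsub>C\<^esub> ?u"
        using w by (auto simp: Hom_def)
    qed
  qed
qed

section \<open>Functors between categories of structured objects\<close>

lemma structured_category_simps [simp]:
  "Ob (structured_category C S P) = S"
  "Dom (structured_category C S P) (A, f, B) = A"
  "Cod (structured_category C S P) (A, f, B) = B"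
  "Ident (structured_category C S P) A = (A, Ident C (fst A), A)"
  "(B, g, D) \<cdot>\<^bsub>structured_category C S P\<^esub> (A, f, B') = (A, g \<cdot>\<^bsub>C\<^esub> f, D)"
  by (simp_all add: structured_category_def)

lemma Arr_structured_category [simp]:
  "(A, f, B) \<in> Arr (structured_category C S P) \<longleftrightarrow>
    A \<in> S \<and> B \<in> S \<and> f \<in> Hom C (fst A) (fst B) \<and> P A f B"
  by (simp add: structured_category_def)

lemma Hom_structured_category:
  "Hom (structured_category C S P) A B =
    (if A \<in> S \<and> B \<in> S then {(A, f, B) |f. f \<in> Hom C (fst A) (fst B) \<and> P A f B} else {})"
  by (auto simp: Hom_def[of "structured_category C S P"])

lemma category_structured_category:
  assumes "category C"
    and Ob: "\<And>A. A \<in> S \<Longrightarrow> fst A \<in> Ob C"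
    and Id: "\<And>A. A \<in> S \<Longrightarrow> P A (Ident C (fst A)) A"
    and Comp: "\<And>A B D f g. \<lbrakk>A \<in> S; B \<in> S; D \<in> S; f \<in> Hom C (fst A) (fst B);
      g \<in> Hom C (fst B) (fst D); P A f B; P B g D\<rbrakk> \<Longrightarrow> P A (g \<cdot>\<^bsub>C\<^esub> f) D"
  shows "category (structured_category C S P)"
proof -
  interpret category C by fact
  show ?thesis
    by unfold_locales
      (auto simp: Hom_structured_category Id_closed Ob Id Id_left Id_right Comp Comp_closed
        Comp_assoc split: if_splits)
qed

text \<open>Compatibility is demanded of the inverse as well, since nothing is assumed about
  \<open>P\<close>.\<close>

lemma isomorphic_structured_category_iff:
  "isomorphic (structured_category C S P) A B \<longleftrightarrow> A \<in> S \<and> B \<in> S \<and>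
    (\<exists>f\<in>Hom C (fst A) (fst B). \<exists>g\<in>Hom C (fst B) (fst A).
      g \<cdot>\<^bsub>C\<^esub> f = Ident C (fst A) \<and> f \<cdot>\<^bsub>C\<^esub> g = Ident C (fst B) \<and> P A f B \<and> P B g A)"
  unfolding isomorphic_iff
  by (cases "A \<in> S \<and> B \<in> S") (auto simp: Hom_structured_category Bex_def)

definition structured_functor ::
  "('o \<times> 's \<Rightarrow> 'p \<times> 't) \<Rightarrow>
    ('o \<times> 's, ('o \<times> 's) \<times> 'm \<times> ('o \<times> 's), 'p \<times> 't, ('p \<times> 't) \<times> 'm \<times> ('p \<times> 't)) functor_data"
  where "structured_functor j = \<lparr>omap = j, amap = (\<lambda>(A, f, B). (j A, f, j B))\<rparr>"

lemma structured_functor_simps [simp]: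
  "omap (structured_functor j) A = j A"
  "amap (structured_functor j) (A, f, B) = (j A, f, j B)"
  by (simp_all add: structured_functor_def)

text \<open>The underlying arrow never changes, so full faithfulness reduces to the two
  compatibility conditions selecting the same arrows. The base categories may differ: below, one of
  them is \<open>End(x)\<close>, whose arrows are arrows of \<open>X\<close>.\<close>

lemma structured_functor_fully_faithful:
  assumes C: "category (structured_category C S P)" and D: "category (structured_category D S' P')"
    and Ob: "\<And>A. A \<in> S \<Longrightarrow> j A \<in> S'"
    and Hom: "\<And>A B f. \<lbrakk>A \<in> S; B \<in> S\<rbrakk> \<Longrightarrow>
      f \<in> Hom C (fst A) (fst B) \<and> P A f B \<longleftrightarrow>
      f \<in> Hom D (fst (j A)) (fst (j B)) \<and> P' (j A) f (j B)"
    and Id: "\<And>A. A \<in> S \<Longrightarrow> Ident C (fst A) = Ident D (fst (j A))"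
    and Comp: "\<And>A f B g E. \<lbrakk>A \<in> S; B \<in> S; E \<in> S; f \<in> Hom C (fst A) (fst B);
      g \<in> Hom C (fst B) (fst E)\<rbrakk> \<Longrightarrow> g \<cdot>\<^bsub>C\<^esub> f = g \<cdot>\<^bsub>D\<^esub> f"
  shows "is_functor (structured_category C S P) (structured_category D S' P') (structured_functor j)"
    and "fully_faithful (structured_category C S P) (structured_category D S' P')
      (structured_functor j)"
proof -
  interpret C: category "structured_category C S P" by fact
  interpret D: category "structured_category D S' P'" by fact
  have HomE: "f \<in> Hom D (fst (j A)) (fst (j B))" "P' (j A) f (j B)"
    if "A \<in> S" "B \<in> S" "f \<in> Hom C (fst A) (fst B)" "P A f B" for A B f
    using Hom[OF that(1,2)] that by blast+
  show "is_functor (structured_category C S P) (structured_category D S' P') (structured_functor j)"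
    by unfold_locales
      (auto simp: Hom_structured_category Ob HomE Id Comp split: if_splits)
  show "fully_faithful (structured_category C S P) (structured_category D S' P')
      (structured_functor j)"
    unfolding fully_faithful_def
  proof (intro ballI bij_betw_imageI)
    fix A B assume "A \<in> Ob (structured_category C S P)" "B \<in> Ob (structured_category C S P)"
    then have AB: "A \<in> S" "B \<in> S" by simp_all
    show "inj_on (amap (structured_functor j)) (Hom (structured_category C S P) A B)"
      by (auto simp: inj_on_def Hom_structured_category split: if_splits)
    have "amap (structured_functor j) ` Hom (structured_category C S P) A B =
      (\<lambda>f. (j A, f, j B)) ` {f. f \<in> Hom C (fst A) (fst B) \<and> P A f B}"
      using AB by (auto simp: Hom_structured_category image_iff)
    also have "{f. f \<in> Hom C (fst A) (fst B) \<and> P A f B} =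
      {f. f \<in> Hom D (fst (j A)) (fst (j B)) \<and> P' (j A) f (j B)}"
      using Hom[OF AB] by simp
    also have "(\<lambda>f. (j A, f, j B)) ` \<dots> =
      Hom (structured_category D S' P') (omap (structured_functor j) A) (omap (structured_functor j) B)"
      using Ob AB by (auto simp: Hom_structured_category)
    finally show "amap (structured_functor j) ` Hom (structured_category C S P) A B =
      Hom (structured_category D S' P') (omap (structured_functor j) A) (omap (structured_functor j) B)" .
  qed
qed

section \<open>Cocycles of a G-category\<close>

lemma Ob_Z1:
  "(x, \<xi>) \<in> Ob (Z1 G X act) \<longleftrightarrow>
    x \<in> Ob X \<and> \<xi> \<in> (\<Pi>\<^sub>E g\<in>carrier G. Hom X (omap (act g) x) x) \<and> \<xi> \<one>\<^bsub>G\<^esub> = Ident X x \<and>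
    (\<forall>h\<in>carrier G. \<forall>g\<in>carrier G. \<xi> (h \<otimes>\<^bsub>G\<^esub> g) = \<xi> h \<cdot>\<^bsub>X\<^esub> amap (act h) (\<xi> g))"
  by (simp add: Z1_def)

text \<open>Isolates the compatibility condition of \<open>Z1\<close>, with projections instead of
  pattern matching, so that general facts on structured categories can be instantiated with
  it.\<close>

definition cocycle_morphism ::
  "('g, 'e) monoid_scheme \<Rightarrow> ('o, 'm) category \<Rightarrow> ('g \<Rightarrow> ('o, 'm, 'o, 'm) functor_data) \<Rightarrow>
    'o \<times> ('g \<Rightarrow> 'm) \<Rightarrow> 'm \<Rightarrow> 'o \<times> ('g \<Rightarrow> 'm) \<Rightarrow> bool" where
  "cocycle_morphism G X act A f B \<longleftrightarrow>
    (\<forall>g\<in>carrier G. f \<cdot>\<^bsub>X\<^esub> snd A g = snd B g \<cdot>\<^bsub>X\<^esub> amap (act g) f)"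

lemma Z1_eq_structured_category:
  "Z1 G X act = structured_category X (Ob (Z1 G X act)) (cocycle_morphism G X act)"
  by (simp add: Z1_def cocycle_morphism_def[abs_def] split_def)

lemma isomorphic_Z1_iff:
  "isomorphic (Z1 G X act) (x, \<xi>) (y, \<upsilon>) \<longleftrightarrow>
    (x, \<xi>) \<in> Ob (Z1 G X act) \<and> (y, \<upsilon>) \<in> Ob (Z1 G X act) \<and>
    (\<exists>f\<in>Hom X x y. \<exists>f'\<in>Hom X y x. f' \<cdot>\<^bsub>X\<^esub> f = Ident X x \<and> f \<cdot>\<^bsub>X\<^esub> f' = Ident X y \<and>
      (\<forall>g\<in>carrier G. f \<cdot>\<^bsub>X\<^esub> \<xi> g = \<upsilon> g \<cdot>\<^bsub>X\<^esub> amap (act g) f) \<and>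
      (\<forall>g\<in>carrier G. f' \<cdot>\<^bsub>X\<^esub> \<upsilon> g = \<xi> g \<cdot>\<^bsub>X\<^esub> amap (act g) f'))"
  unfolding Z1_def isomorphic_structured_category_iff by simp

lemma isomorphic_Z1_underlying:
  "isomorphic (Z1 G X act) (x, \<xi>) (y, \<upsilon>) \<Longrightarrow> isomorphic X x y"
  unfolding isomorphic_Z1_iff isomorphic_iff[of X] by blast

context G_category
begin

context
  fixes g assumes g: "g \<in> carrier G"
begin

interpretation act: is_functor X X "act g"
  by (rule act_functor[OF g])

lemma act_omap [simp]: "x \<in> Ob X \<Longrightarrow> omap (act g) x \<in> Ob X"
  by simp

lemma act_amap_simps [simp]:
  assumes "f \<in> Arr X"
  shows "amap (act g) f \<in> Arr X" "Dom X (amap (act g) f) = omap (act g) (Dom X f)"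
    "Cod X (amap (act g) f) = omap (act g) (Cod X f)"
  using assms by simp_all

lemma act_Ident [simp]: "x \<in> Ob X \<Longrightarrow> amap (act g) (Ident X x) = Ident X (omap (act g) x)"
  by simp

lemma act_Comp [simp]:
  "\<lbrakk>f \<in> Arr X; k \<in> Arr X; Dom X k = Cod X f\<rbrakk> \<Longrightarrow>
    amap (act g) (k \<cdot>\<^bsub>X\<^esub> f) = amap (act g) k \<cdot>\<^bsub>X\<^esub> amap (act g) f"
  by simp

lemma act_is_iso [simp]: "is_iso X f \<Longrightarrow> is_iso X (amap (act g) f)"
  by simp

lemma act_inv_arrow [simp]:
  "is_iso X f \<Longrightarrow> amap (act g) (inv_arrow X f) = inv_arrow X (amap (act g) f)"
  by (rule act.amap_inv_arrow)

end

lemma act_one_simps [simp]: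
  "x \<in> Ob X \<Longrightarrow> omap (act \<one>\<^bsub>G\<^esub>) x = x" "f \<in> Arr X \<Longrightarrow> amap (act \<one>\<^bsub>G\<^esub>) f = f"
  using act_one by (simp_all add: functor_eq_def)

lemma act_mult_simps [simp]:
  assumes "h \<in> carrier G" "g \<in> carrier G"
  shows "x \<in> Ob X \<Longrightarrow> omap (act (h \<otimes>\<^bsub>G\<^esub> g)) x = omap (act h) (omap (act g) x)"
    "f \<in> Arr X \<Longrightarrow> amap (act (h \<otimes>\<^bsub>G\<^esub> g)) f = amap (act h) (amap (act g) f)"
  using act_mult[OF assms] by (simp_all add: functor_eq_def)

lemma act_inv_cancel [simp]:
  assumes g: "g \<in> carrier G"
  shows "x \<in> Ob X \<Longrightarrow> omap (act g) (omap (act (inv\<^bsub>G\<^esub> g)) x) = x"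
    and "x \<in> Ob X \<Longrightarrow> omap (act (inv\<^bsub>G\<^esub> g)) (omap (act g) x) = x"
    and "f \<in> Arr X \<Longrightarrow> amap (act g) (amap (act (inv\<^bsub>G\<^esub> g)) f) = f"
    and "f \<in> Arr X \<Longrightarrow> amap (act (inv\<^bsub>G\<^esub> g)) (amap (act g) f) = f"
  using act_mult_simps[OF g inv_closed[OF g], symmetric]
    act_mult_simps[OF inv_closed[OF g] g, symmetric] g
  by (simp_all del: act_mult_simps)

lemma act_faithful:
  assumes "g \<in> carrier G" "f \<in> Arr X" "k \<in> Arr X" "amap (act g) f = amap (act g) k"
  shows "f = k"
  using act_inv_cancel(4)[OF assms(1,2)] act_inv_cancel(4)[OF assms(1,3)] assms(4) by argo

lemma cocycle_simps:
  assumes "(x, \<xi>) \<in> Ob (Z1 G X act)"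
  shows "x \<in> Ob X"
    and "g \<in> carrier G \<Longrightarrow> \<xi> g \<in> Arr X"
    and "g \<in> carrier G \<Longrightarrow> Dom X (\<xi> g) = omap (act g) x"
    and "g \<in> carrier G \<Longrightarrow> Cod X (\<xi> g) = x"
    and "\<xi> \<one>\<^bsub>G\<^esub> = Ident X x"
    and "\<lbrakk>h \<in> carrier G; g \<in> carrier G\<rbrakk> \<Longrightarrow> \<xi> (h \<otimes>\<^bsub>G\<^esub> g) = \<xi> h \<cdot>\<^bsub>X\<^esub> amap (act h) (\<xi> g)"
  using assms by (auto simp: Ob_Z1 Hom_def PiE_iff)

text \<open>The inverse of \<open>\<xi> g\<close> is \<open>g\<close> applied to
  \<open>\<xi>\<close> at the inverse of \<open>g\<close>: the cocycle law for the pair consisting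
  of \<open>g\<close> and its inverse gives one equation, the law for the reversed pair the
  other.\<close>

lemma cocycle_is_iso:
  assumes \<xi>: "(x, \<xi>) \<in> Ob (Z1 G X act)" and g: "g \<in> carrier G"
  shows "is_iso X (\<xi> g)"
proof (rule is_isoI)
  note [simp] = cocycle_simps[OF \<xi>] g
  let ?k = "amap (act g) (\<xi> (inv\<^bsub>G\<^esub> g))"
  show "\<xi> g \<in> Hom X (omap (act g) x) x" "?k \<in> Hom X x (omap (act g) x)"
    by (auto simp: Hom_def)
  show "\<xi> g \<cdot>\<^bsub>X\<^esub> ?k = Ident X x"
    by (simp flip: cocycle_simps(6)[OF \<xi>])
  \<comment> \<open>Rewriting \<open>\<xi> g\<close> as \<open>g\<close> of its image under the
    inverse of \<open>g\<close> makes the whole composite a value of the functor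
    \<open>g(-)\<close>.\<close>
  have "?k \<cdot>\<^bsub>X\<^esub> \<xi> g = amap (act g) (\<xi> (inv\<^bsub>G\<^esub> g) \<cdot>\<^bsub>X\<^esub> amap (act (inv\<^bsub>G\<^esub> g)) (\<xi> g))"
    by simp
  also have "\<dots> = amap (act g) (\<xi> (inv\<^bsub>G\<^esub> g \<otimes>\<^bsub>G\<^esub> g))"
    by (simp only: cocycle_simps(6)[OF \<xi> inv_closed[OF g] g])
  also have "\<dots> = Ident X (omap (act g) x)"
    by (simp del: cocycle_simps(6)[OF \<xi>])
  finally show "?k \<cdot>\<^bsub>X\<^esub> \<xi> g = Ident X (omap (act g) x)" .
qed

lemma category_Z1: "category (Z1 G X act)"
proof (subst Z1_eq_structured_category, rule category_structured_category)
  fix A B D f k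
  assume obs: "A \<in> Ob (Z1 G X act)" "B \<in> Ob (Z1 G X act)" "D \<in> Ob (Z1 G X act)"
    and f: "f \<in> Hom X (fst A) (fst B)" "k \<in> Hom X (fst B) (fst D)"
    and P: "cocycle_morphism G X act A f B" "cocycle_morphism G X act B k D"
  obtain x \<xi> y \<upsilon> z \<zeta> where eqs: "A = (x, \<xi>)" "B = (y, \<upsilon>)" "D = (z, \<zeta>)"
    by (cases A; cases B; cases D)
  note [simp] = obs[unfolded eqs, THEN cocycle_simps(1)] obs[unfolded eqs, THEN cocycle_simps(2)]
    obs[unfolded eqs, THEN cocycle_simps(3)] obs[unfolded eqs, THEN cocycle_simps(4)]
  have [simp]: "f \<in> Arr X" "Dom X f = x" "Cod X f = y" "k \<in> Arr X" "Dom X k = y" "Cod X k = z"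
    using f eqs by (auto simp: Hom_def)
  have fk: "f \<cdot>\<^bsub>X\<^esub> \<xi> g = \<upsilon> g \<cdot>\<^bsub>X\<^esub> amap (act g) f" "k \<cdot>\<^bsub>X\<^esub> \<upsilon> g = \<zeta> g \<cdot>\<^bsub>X\<^esub> amap (act g) k"
    if "g \<in> carrier G" for g
    using P that by (auto simp: eqs cocycle_morphism_def)
  have "(k \<cdot>\<^bsub>X\<^esub> f) \<cdot>\<^bsub>X\<^esub> \<xi> g = \<zeta> g \<cdot>\<^bsub>X\<^esub> amap (act g) (k \<cdot>\<^bsub>X\<^esub> f)" if g [simp]: "g \<in> carrier G" for g
  proof -
    have "(k \<cdot>\<^bsub>X\<^esub> f) \<cdot>\<^bsub>X\<^esub> \<xi> g = (k \<cdot>\<^bsub>X\<^esub> \<upsilon> g) \<cdot>\<^bsub>X\<^esub> amap (act g) f"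
      by (simp add: fk(1))
    also have "\<dots> = \<zeta> g \<cdot>\<^bsub>X\<^esub> amap (act g) (k \<cdot>\<^bsub>X\<^esub> f)"
      unfolding fk(2)[OF g] by simp
    finally show ?thesis .
  qed
  then show "cocycle_morphism G X act A (k \<cdot>\<^bsub>X\<^esub> f) D"
    by (simp add: eqs cocycle_morphism_def)
next
  fix A assume "A \<in> Ob (Z1 G X act)"
  then show "fst A \<in> Ob X" "cocycle_morphism G X act A (Ident X (fst A)) A"
    using cocycle_simps[of "fst A" "snd A"] by (simp_all add: cocycle_morphism_def)
qed (rule category_axioms)

text \<open>The structure on \<open>y\<close> is forced by requiring \<open>t\<close> to be a
  morphism: \<open>t \<cdot> \<xi> g \<cdot> g(t)\<close> with the last factor inverted. In the
  cocycle law for it, the inner copies of \<open>t\<close> cancel.\<close>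

lemma transport_cocycle:
  assumes \<xi>: "(x, \<xi>) \<in> Ob (Z1 G X act)" and t: "t \<in> Hom X x y" "is_iso X t"
  obtains \<upsilon> where "isomorphic (Z1 G X act) (x, \<xi>) (y, \<upsilon>)"
proof
  note [simp] = cocycle_simps[OF \<xi>] t(2)
  have [simp]: "t \<in> Arr X" "Dom X t = x" "Cod X t = y" "y \<in> Ob X"
    using t by (auto simp: Hom_def)
  define \<upsilon> where "\<upsilon> = (\<lambda>g\<in>carrier G. t \<cdot>\<^bsub>X\<^esub> \<xi> g \<cdot>\<^bsub>X\<^esub> amap (act g) (inv_arrow X t))"
  have "(y, \<upsilon>) \<in> Ob (Z1 G X act)"
    unfolding Ob_Z1 by (auto simp: \<upsilon>_def Hom_def)
  moreover have "t \<cdot>\<^bsub>X\<^esub> \<xi> g = \<upsilon> g \<cdot>\<^bsub>X\<^esub> amap (act g) t"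
    and "inv_arrow X t \<cdot>\<^bsub>X\<^esub> \<upsilon> g = \<xi> g \<cdot>\<^bsub>X\<^esub> amap (act g) (inv_arrow X t)" if "g \<in> carrier G" for g
    using that by (simp_all add: \<upsilon>_def)
  ultimately show "isomorphic (Z1 G X act) (x, \<xi>) (y, \<upsilon>)"
    unfolding isomorphic_Z1_iff using \<xi> t(1)
    by (intro conjI bexI[of _ t] bexI[of _ "inv_arrow X t"]) (auto simp: Hom_def)
qed

end

section \<open>Twisting by a cocycle\<close>

lemma one_object_category_simps [simp]:
  "Ob (one_object_category M) = {()}"
  "Arr (one_object_category M) = carrier M"
  "Hom (one_object_category M) a b = carrier M"
  "Ident (one_object_category M) a = \<one>\<^bsub>M\<^esub>"
  "f \<cdot>\<^bsub>one_object_category M\<^esub> k = f \<otimes>\<^bsub>M\<^esub> k"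
  by (simp_all add: one_object_category_def Hom_def)

lemma End_monoid_simps [simp]:
  "carrier (End_monoid X x) = Hom X x x"
  "\<one>\<^bsub>End_monoid X x\<^esub> = Ident X x"
  "f \<otimes>\<^bsub>End_monoid X x\<^esub> k = f \<cdot>\<^bsub>X\<^esub> k"
  by (simp_all add: End_monoid_def)

lemma Aut_group_simps [simp]:
  "carrier (Aut_group X x) = Units (End_monoid X x)"
  "\<one>\<^bsub>Aut_group X x\<^esub> = Ident X x"
  "f \<otimes>\<^bsub>Aut_group X x\<^esub> k = f \<cdot>\<^bsub>X\<^esub> k"
  by (simp_all add: Aut_group_def units_of_def)

lemma twisted_action_simps [simp]:
  "omap (twisted_action X act \<xi> g) a = ()"
  "amap (twisted_action X act \<xi> g) f = \<xi> g \<cdot>\<^bsub>X\<^esub> amap (act g) f \<cdot>\<^bsub>X\<^esub> inv_arrow X (\<xi> g)"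
  by (simp_all add: twisted_action_def)

locale G_category_cocycle = G_category G X act
  for G :: "('g, 'e) monoid_scheme" and X :: "('o, 'm) category" and act +
  fixes x :: 'o and \<xi> :: "'g \<Rightarrow> 'm"
  assumes cocycle: "(x, \<xi>) \<in> Ob (Z1 G X act)"
begin

lemmas \<xi>_simps [simp] = cocycle_simps[OF cocycle]

lemma \<xi>_is_iso [simp]: "g \<in> carrier G \<Longrightarrow> is_iso X (\<xi> g)"
  by (rule cocycle_is_iso[OF cocycle])

abbreviation "E \<equiv> one_object_category (End_monoid X x)"

abbreviation "A \<equiv> one_object_category (Aut_group X x)"

abbreviation "tw \<equiv> twisted_action X act \<xi>"

lemma category_E: "category E"
  by unfold_locales (auto simp: Hom_def)

text \<open>Twisting by \<open>h\<close> after \<open>g\<close> conjugates by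
  \<open>\<xi> h \<cdot> h(\<xi> g)\<close>, which is \<open>\<xi>\<close> at the product by the
  cocycle law; hence the action is strict.\<close>

lemma G_category_E: "G_category G E tw"
proof -
  interpret E: category E by (rule category_E)
  show ?thesis
  proof (intro G_category.intro G_category_axioms.intro group_axioms category_E)
    show "is_functor E E (tw g)" if "g \<in> carrier G" for g
      using that by unfold_locales (auto simp: Hom_def)
    show "functor_eq E (tw \<one>\<^bsub>G\<^esub>) id_functor"
      by (auto simp: functor_eq_def Hom_def inv_arrow_eq[of "Ident X x" "Ident X x"] inverse_arrows_def)
    show "functor_eq E (tw (h \<otimes>\<^bsub>G\<^esub> g)) (tw h \<circ>\<^sub>F tw g)" if "h \<in> carrier G" "g \<in> carrier G" for h g
      using that by (auto simp: functor_eq_def Hom_def inv_arrow_Comp)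
  qed
qed

lemma Ob_Z1_E:
  "((), \<phi>) \<in> Ob (Z1 G E tw) \<longleftrightarrow>
    \<phi> \<in> (\<Pi>\<^sub>E g\<in>carrier G. Hom X x x) \<and> \<phi> \<one>\<^bsub>G\<^esub> = Ident X x \<and>
    (\<forall>h\<in>carrier G. \<forall>g\<in>carrier G.
      \<phi> (h \<otimes>\<^bsub>G\<^esub> g) = \<phi> h \<cdot>\<^bsub>X\<^esub> \<xi> h \<cdot>\<^bsub>X\<^esub> amap (act h) (\<phi> g) \<cdot>\<^bsub>X\<^esub> inv_arrow X (\<xi> h))"
  by (simp add: Ob_Z1)

text \<open>A cocycle of the twisted monoid is the ratio of a cocycle on \<open>x\<close> to the base cocycle \<open>\<xi>\<close>.\<close>

definition untwist :: "unit \<times> ('g \<Rightarrow> 'm) \<Rightarrow> 'o \<times> ('g \<Rightarrow> 'm)" where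
  "untwist = (\<lambda>(_, \<phi>). (x, \<lambda>g\<in>carrier G. \<phi> g \<cdot>\<^bsub>X\<^esub> \<xi> g))"

text \<open>The twisted cocycle law ends in the inverse of \<open>\<xi> h\<close>, which cancels the
  first factor of \<open>\<xi> h \<cdot> h(\<xi> g)\<close>; what remains is the plain cocycle law
  for the products \<open>\<phi> g \<cdot> \<xi> g\<close>.\<close>

lemma untwist_Ob:
  assumes "B \<in> Ob (Z1 G E tw)"
  shows "untwist B \<in> Ob (Z1 G X act)"
proof -
  obtain \<phi> where B: "B = ((), \<phi>)" by (cases B) auto
  with assms have \<phi>: "\<phi> g \<in> Arr X" "Dom X (\<phi> g) = x" "Cod X (\<phi> g) = x" if "g \<in> carrier G" for g
    using that by (auto simp: Ob_Z1_E Hom_def PiE_iff)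
  from assms B have "\<phi> \<one>\<^bsub>G\<^esub> = Ident X x"
    and "\<And>h g. \<lbrakk>h \<in> carrier G; g \<in> carrier G\<rbrakk> \<Longrightarrow>
      \<phi> (h \<otimes>\<^bsub>G\<^esub> g) = \<phi> h \<cdot>\<^bsub>X\<^esub> \<xi> h \<cdot>\<^bsub>X\<^esub> amap (act h) (\<phi> g) \<cdot>\<^bsub>X\<^esub> inv_arrow X (\<xi> h)"
    by (auto simp: Ob_Z1_E)
  then show ?thesis
    unfolding untwist_def B by (auto simp: Ob_Z1 Hom_def \<phi>)
qed

text \<open>The preimage is the ratio of \<upsilon> to \<xi>. Every cocycle whose underlying object
  is exactly \<open>x\<close> is reached, on the nose.\<close>

lemma untwist_surj:
  assumes \<upsilon>: "(x, \<upsilon>) \<in> Ob (Z1 G X act)"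
  shows "\<exists>B\<in>Ob (Z1 G E tw). untwist B = (x, \<upsilon>)"
proof
  note [simp] = cocycle_simps[OF \<upsilon>]
  define \<phi> where "\<phi> = (\<lambda>g\<in>carrier G. \<upsilon> g \<cdot>\<^bsub>X\<^esub> inv_arrow X (\<xi> g))"
  have "inv_arrow X (Ident X x) = Ident X x"
    by (rule inv_arrow_eq) (auto simp: inverse_arrows_def Hom_def)
  then show "((), \<phi>) \<in> Ob (Z1 G E tw)"
    by (auto simp: Ob_Z1_E \<phi>_def Hom_def inv_arrow_Comp)
  \<comment> \<open>An equality of functions, not only of values on the group: both sides are
    extensional on the carrier.\<close>
  have "(\<lambda>g\<in>carrier G. \<phi> g \<cdot>\<^bsub>X\<^esub> \<xi> g) = \<upsilon>"
    using \<upsilon> by (auto simp: \<phi>_def Ob_Z1 PiE_iff extensional_def fun_eq_iff)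
  then show "untwist ((), \<phi>) = (x, \<upsilon>)"
    by (simp add: untwist_def)
qed

text \<open>The second equation is the first composed on the right with the isomorphism
  \<open>\<xi> g\<close>, the inverse inside the twisted action being absorbed.\<close>

lemma untwist_Hom:
  assumes "((), \<phi>) \<in> Ob (Z1 G E tw)" "((), \<psi>) \<in> Ob (Z1 G E tw)"
    and "f \<in> Hom X x x" and g [simp]: "g \<in> carrier G"
  shows "f \<cdot>\<^bsub>X\<^esub> \<phi> g = \<psi> g \<cdot>\<^bsub>X\<^esub> amap (tw g) f \<longleftrightarrow>
    f \<cdot>\<^bsub>X\<^esub> \<phi> g \<cdot>\<^bsub>X\<^esub> \<xi> g = (\<psi> g \<cdot>\<^bsub>X\<^esub> \<xi> g) \<cdot>\<^bsub>X\<^esub> amap (act g) f" (is "?l = ?r \<longleftrightarrow> ?l' = ?r'")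
proof -
  have [simp]: "\<phi> g \<in> Arr X" "Dom X (\<phi> g) = x" "Cod X (\<phi> g) = x"
    "\<psi> g \<in> Arr X" "Dom X (\<psi> g) = x" "Cod X (\<psi> g) = x" "f \<in> Arr X" "Dom X f = x" "Cod X f = x"
    using assms by (auto simp: Ob_Z1_E Hom_def PiE_iff)
  have l': "?l' = ?l \<cdot>\<^bsub>X\<^esub> \<xi> g" and r': "?r' = ?r \<cdot>\<^bsub>X\<^esub> \<xi> g"
    by simp_all
  show ?thesis
  proof
    assume "?l' = ?r'"
    then have "?l \<cdot>\<^bsub>X\<^esub> \<xi> g = ?r \<cdot>\<^bsub>X\<^esub> \<xi> g"
      by (simp only: l' r')
    then show "?l = ?r"
      by (rule iso_cancel_right[of "\<xi> g", rotated -1]) simp_all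
  qed (simp only: l' r')
qed

lemma untwist_fully_faithful:
  shows "is_functor (Z1 G E tw) (Z1 G X act) (structured_functor untwist)"
    and "fully_faithful (Z1 G E tw) (Z1 G X act) (structured_functor untwist)"
proof -
  interpret E: G_category G E tw by (rule G_category_E)
  note ff = structured_functor_fully_faithful[where C = E and S = "Ob (Z1 G E tw)"
      and P = "cocycle_morphism G E tw" and D = X and S' = "Ob (Z1 G X act)"
      and P' = "cocycle_morphism G X act" and j = untwist,
      folded Z1_eq_structured_category, OF E.category_Z1 category_Z1]
  have Hom: "f \<in> Hom E (fst B) (fst B') \<and> cocycle_morphism G E tw B f B' \<longleftrightarrow>
      f \<in> Hom X (fst (untwist B)) (fst (untwist B')) \<and>
      cocycle_morphism G X act (untwist B) f (untwist B')"
    if B: "B \<in> Ob (Z1 G E tw)" "B' \<in> Ob (Z1 G E tw)" for B B' f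
  proof -
    obtain \<phi> \<psi> where eqs: "B = ((), \<phi>)" "B' = ((), \<psi>)" by (cases B; cases B') auto
    show ?thesis
      using untwist_Hom[OF B[unfolded eqs]]
      by (auto simp: eqs cocycle_morphism_def untwist_def simp del: twisted_action_simps)
  qed
  show "is_functor (Z1 G E tw) (Z1 G X act) (structured_functor untwist)"
    by (rule ff(1)[OF untwist_Ob Hom]) (auto simp: untwist_def split_def)
  show "fully_faithful (Z1 G E tw) (Z1 G X act) (structured_functor untwist)"
    by (rule ff(2)[OF untwist_Ob Hom]) (auto simp: untwist_def split_def)
qed

text \<open>A cocycle in the monoid already takes values in units, so both categories have the same
  objects. Their isomorphisms also agree, since an arrow invertible in \<open>End(x)\<close> is a
  unit; hence the sets of classes are literally equal.\<close>

lemma H1_E_eq_H1_A: "H1 G E tw = H1 G A tw"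
proof -
  interpret E: G_category G E tw by (rule G_category_E)
  have Units: "f \<in> Units (End_monoid X x) \<longleftrightarrow>
    f \<in> Hom X x x \<and> (\<exists>k\<in>Hom X x x. k \<cdot>\<^bsub>X\<^esub> f = Ident X x \<and> f \<cdot>\<^bsub>X\<^esub> k = Ident X x)" for f
    by (auto simp: Units_def)
  \<comment> \<open>The general invertibility of cocycle components, applied to \<open>E\<close> as
    a category with the twisted action.\<close>
  have "\<phi> g \<in> Units (End_monoid X x)" if "((), \<phi>) \<in> Ob (Z1 G E tw)" "g \<in> carrier G" for \<phi> g
    using E.cocycle_is_iso[OF that] by (auto simp: Units is_iso_def inverse_arrows_def)
  then have Ob: "((), \<phi>) \<in> Ob (Z1 G E tw) \<longleftrightarrow> ((), \<phi>) \<in> Ob (Z1 G A tw)" for \<phi>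
    unfolding Ob_Z1 by (auto simp: PiE_iff Units)
  have "isomorphic (Z1 G E tw) ((), \<phi>) ((), \<psi>) \<longleftrightarrow> isomorphic (Z1 G A tw) ((), \<phi>) ((), \<psi>)" for \<phi> \<psi>
    unfolding isomorphic_Z1_iff Ob
    by (simp add: Units Bex_def del: twisted_action_simps) blast
  then have "isomorphic (Z1 G E tw) B B' \<longleftrightarrow> isomorphic (Z1 G A tw) B B'" for B B'
    by (cases B; cases B') simp
  moreover have "Ob (Z1 G E tw) = Ob (Z1 G A tw)"
    using Ob by auto
  ultimately show ?thesis
    by (simp add: H1_def iso_classes_def)
qed

end

section \<open>Cocycles as algebras\<close>

context G_galois_adjunction
begin

section \<open>The coproduct structure of \<open>UF(x)\<close>\<close>

lemma F_act_simps [simp]: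
  assumes "g \<in> carrier G"
  shows "x \<in> Ob X \<Longrightarrow> omap F (omap (act g) x) = omap F x"
    and "f \<in> Arr X \<Longrightarrow> amap F (amap (act g) f) = amap F f"
  using F_act[OF assms] by (simp_all add: functor_eq_def)

lemma \<eta>_simps [simp]:
  assumes "x \<in> Ob X"
  shows "\<eta> x \<in> Arr X" "Dom X (\<eta> x) = x" "Cod X (\<eta> x) = omap U (omap F x)"
  using unit.component_simps[OF assms] by simp_all

lemma \<epsilon>_simps [simp]:
  assumes "y \<in> Ob Y"
  shows "\<epsilon> y \<in> Arr Y" "Dom Y (\<epsilon> y) = omap F (omap U y)" "Cod Y (\<epsilon> y) = y"
  using counit.component_simps[OF assms] by simp_all

lemma \<eta>_natural:
  "f \<in> Arr X \<Longrightarrow> \<eta> (Cod X f) \<cdot>\<^bsub>X\<^esub> f = amap U (amap F f) \<cdot>\<^bsub>X\<^esub> \<eta> (Dom X f)"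
  using unit.naturality_arr[of f] by simp

text \<open>Naturality of \<eta> at \<open>g(f)\<close>; the right-hand side forgets
  \<open>g\<close> because \<open>F(g(f)) = F(f)\<close>.\<close>

lemma \<eta>_act_natural:
  assumes "g \<in> carrier G" "f \<in> Arr X"
  shows "\<eta> (omap (act g) (Cod X f)) \<cdot>\<^bsub>X\<^esub> amap (act g) f =
    amap U (amap F f) \<cdot>\<^bsub>X\<^esub> \<eta> (omap (act g) (Dom X f))"
  using \<eta>_natural[of "amap (act g) f"] assms by simp

text \<open>Some coproduct of the objects \<open>g(x)\<close> exists; its comparison arrow to
  \<open>UF(x)\<close> is invertible by the Galois condition, so the universal property moves along
  it.\<close>

lemma coproduct_\<eta>:
  assumes x: "x \<in> Ob X"
  shows "is_coproduct X (carrier G) (\<lambda>g. omap (act g) x) (omap U (omap F x))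
    (\<lambda>g. \<eta> (omap (act g) x))"
proof -
  obtain c i where cop: "is_coproduct X (carrier G) (\<lambda>g. omap (act g) x) c i"
    using G_coproducts x unfolding has_coproducts_def by (meson act_omap)
  then have "\<exists>!u. u \<in> Hom X c (omap U (omap F x)) \<and>
      (\<forall>g\<in>carrier G. u \<cdot>\<^bsub>X\<^esub> i g = \<eta> (omap (act g) x))"
    by (rule is_coproduct_universal) (use x in \<open>simp_all add: Hom_def\<close>)
  then obtain u where u: "u \<in> Hom X c (omap U (omap F x))"
    and ui: "\<And>g. g \<in> carrier G \<Longrightarrow> u \<cdot>\<^bsub>X\<^esub> i g = \<eta> (omap (act g) x)"
    by blast
  have "is_iso X u"
    by (rule induced_iso[OF x cop u ui])
  then show ?thesis
    by (rule is_coproduct_iso[OF category_axioms cop u _ ui])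
qed

lemma \<eta>_jointly_epic:
  assumes "x \<in> Ob X" "u \<in> Hom X (omap U (omap F x)) d" "v \<in> Hom X (omap U (omap F x)) d"
    and eq: "\<And>g. g \<in> carrier G \<Longrightarrow> u \<cdot>\<^bsub>X\<^esub> \<eta> (omap (act g) x) = v \<cdot>\<^bsub>X\<^esub> \<eta> (omap (act g) x)"
  shows "u = v"
proof -
  have "\<exists>!w. w \<in> Hom X (omap U (omap F x)) d \<and>
      (\<forall>g\<in>carrier G. w \<cdot>\<^bsub>X\<^esub> \<eta> (omap (act g) x) = v \<cdot>\<^bsub>X\<^esub> \<eta> (omap (act g) x))"
    by (rule is_coproduct_universal[OF coproduct_\<eta>[OF assms(1)]])
      (use assms(1-3) in \<open>auto simp: Hom_def\<close>)
  then show ?thesis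
    using assms(2,3) eq by blast
qed

text \<open>The uniqueness half of the statement that \<open>h(-)\<close> preserves this coproduct:
  apply the inverse action, use joint epicity there, and return by faithfulness.\<close>

lemma act_\<eta>_jointly_epic:
  assumes x: "x \<in> Ob X" and h: "h \<in> carrier G"
    and u: "u \<in> Hom X (omap (act h) (omap U (omap F x))) d"
    and v: "v \<in> Hom X (omap (act h) (omap U (omap F x))) d"
    and eq: "\<And>g. g \<in> carrier G \<Longrightarrow>
      u \<cdot>\<^bsub>X\<^esub> amap (act h) (\<eta> (omap (act g) x)) = v \<cdot>\<^bsub>X\<^esub> amap (act h) (\<eta> (omap (act g) x))"
  shows "u = v"
proof -
  let ?k = "inv\<^bsub>G\<^esub> h"
  have [simp]: "u \<in> Arr X" "Dom X u = omap (act h) (omap U (omap F x))" "Cod X u = d"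
    "v \<in> Arr X" "Dom X v = omap (act h) (omap U (omap F x))" "Cod X v = d" "d \<in> Ob X"
    using u v by (auto simp: Hom_def)
  have "amap (act ?k) u = amap (act ?k) v"
  proof (rule \<eta>_jointly_epic[OF x])
    show "amap (act ?k) u \<in> Hom X (omap U (omap F x)) (omap (act ?k) d)"
      "amap (act ?k) v \<in> Hom X (omap U (omap F x)) (omap (act ?k) d)"
      using x h by (auto simp: Hom_def)
    show "amap (act ?k) u \<cdot>\<^bsub>X\<^esub> \<eta> (omap (act g) x) = amap (act ?k) v \<cdot>\<^bsub>X\<^esub> \<eta> (omap (act g) x)"
      if g: "g \<in> carrier G" for g
      using arg_cong[OF eq[OF g], of "amap (act ?k)"] g x h by simp
  qed
  then show ?thesis
    using h by (auto intro: act_faithful[of ?k])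
qed

section \<open>Algebras of the monad \<open>UF\<close> compared with 1-cocycles\<close>

definition algebra_cocycle :: "'o \<times> 'm \<Rightarrow> 'o \<times> ('g \<Rightarrow> 'm)" where
  "algebra_cocycle = (\<lambda>(x, \<theta>). (x, \<lambda>g\<in>carrier G. \<theta> \<cdot>\<^bsub>X\<^esub> \<eta> (omap (act g) x)))"

abbreviation "EM \<equiv> eilenberg_moore X (U \<circ>\<^sub>F F) \<eta> (\<lambda>x. amap U (\<epsilon> (omap F x)))"

lemma Ob_EM:
  "(x, \<theta>) \<in> Ob EM \<longleftrightarrow> x \<in> Ob X \<and> \<theta> \<in> Hom X (omap U (omap F x)) x \<and>
    \<theta> \<cdot>\<^bsub>X\<^esub> \<eta> x = Ident X x \<and>
    \<theta> \<cdot>\<^bsub>X\<^esub> amap U (amap F \<theta>) = \<theta> \<cdot>\<^bsub>X\<^esub> amap U (\<epsilon> (omap F x))"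
  by (simp add: eilenberg_moore_def)

definition algebra_morphism :: "'o \<times> 'm \<Rightarrow> 'm \<Rightarrow> 'o \<times> 'm \<Rightarrow> bool" where
  "algebra_morphism A f B \<longleftrightarrow> f \<cdot>\<^bsub>X\<^esub> snd A = snd B \<cdot>\<^bsub>X\<^esub> amap U (amap F f)"

lemma EM_eq_structured_category: "EM = structured_category X (Ob EM) algebra_morphism"
  by (simp add: eilenberg_moore_def algebra_morphism_def[abs_def] split_def)

text \<open>Restricted to the summand \<open>h(g(x))\<close> of \<open>T(T(x))\<close>, where \<open>T = UF\<close>, the associativity law
  \<open>\<theta> \<cdot> T(\<theta>) = \<theta> \<cdot> \<mu>\<close> becomes the cocycle law for the pair \<open>(h, g)\<close>.\<close>

lemma algebra_iff_cocycle:
  assumes x: "x \<in> Ob X" and \<theta>: "\<theta> \<in> Hom X (omap U (omap F x)) x"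
  shows "(x, \<theta>) \<in> Ob EM \<longleftrightarrow> algebra_cocycle (x, \<theta>) \<in> Ob (Z1 G X act)"
proof -
  let ?\<mu> = "amap U (\<epsilon> (omap F x))"
  let ?T = "omap U (omap F x)"
  let ?\<xi> = "\<lambda>g. \<theta> \<cdot>\<^bsub>X\<^esub> \<eta> (omap (act g) x)"
  have [simp]: "x \<in> Ob X" "\<theta> \<in> Arr X" "Dom X \<theta> = ?T" "Cod X \<theta> = x"
    using x \<theta> by (auto simp: Hom_def)
  \<comment> \<open>Both sides of the cocycle law are brought to a common form: an arrow out of
    \<open>T(T(x))\<close> composed with the inclusion of \<open>h(g(x))\<close>, which is \<eta> at
    \<open>h(T(x))\<close> after \<open>h\<close> of \<eta> at \<open>g(x)\<close>.\<close>
  have lhs: "?\<xi> h \<cdot>\<^bsub>X\<^esub> amap (act h) (?\<xi> g) =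
      ((\<theta> \<cdot>\<^bsub>X\<^esub> amap U (amap F \<theta>)) \<cdot>\<^bsub>X\<^esub> \<eta> (omap (act h) ?T)) \<cdot>\<^bsub>X\<^esub> amap (act h) (\<eta> (omap (act g) x))"
    if hg [simp]: "h \<in> carrier G" "g \<in> carrier G" for h g
  proof -
    have "?\<xi> h \<cdot>\<^bsub>X\<^esub> amap (act h) (?\<xi> g) =
        \<theta> \<cdot>\<^bsub>X\<^esub> (\<eta> (omap (act h) x) \<cdot>\<^bsub>X\<^esub> amap (act h) \<theta>) \<cdot>\<^bsub>X\<^esub> amap (act h) (\<eta> (omap (act g) x))"
      by simp
    also have "\<eta> (omap (act h) x) \<cdot>\<^bsub>X\<^esub> amap (act h) \<theta> =
        amap U (amap F \<theta>) \<cdot>\<^bsub>X\<^esub> \<eta> (omap (act h) ?T)"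
      using \<eta>_act_natural[OF hg(1), of \<theta>] by simp
    finally show ?thesis by simp
  qed
  have rhs: "?\<xi> (h \<otimes>\<^bsub>G\<^esub> g) =
      ((\<theta> \<cdot>\<^bsub>X\<^esub> ?\<mu>) \<cdot>\<^bsub>X\<^esub> \<eta> (omap (act h) ?T)) \<cdot>\<^bsub>X\<^esub> amap (act h) (\<eta> (omap (act g) x))"
    if hg [simp]: "h \<in> carrier G" "g \<in> carrier G" for h g
  proof -
    \<comment> \<open>The triangle identity at \<open>g(x)\<close>, read at \<open>x\<close> because
      \<open>F(g(x)) = F(x)\<close>.\<close>
    have "\<epsilon> (omap F x) \<cdot>\<^bsub>Y\<^esub> amap F (\<eta> (omap (act g) x)) = Ident Y (omap F x)"
      using triangle_F[of "omap (act g) x"] by simp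
    from arg_cong[OF this, of "amap U"]
    have "?\<mu> \<cdot>\<^bsub>X\<^esub> amap U (amap F (\<eta> (omap (act g) x))) = Ident X ?T"
      by simp
    then have "\<eta> (omap (act (h \<otimes>\<^bsub>G\<^esub> g)) x) =
        (?\<mu> \<cdot>\<^bsub>X\<^esub> amap U (amap F (\<eta> (omap (act g) x)))) \<cdot>\<^bsub>X\<^esub> \<eta> (omap (act h) (omap (act g) x))"
      by simp
    also have "\<dots> = ?\<mu> \<cdot>\<^bsub>X\<^esub> (\<eta> (omap (act h) ?T) \<cdot>\<^bsub>X\<^esub> amap (act h) (\<eta> (omap (act g) x)))"
      using \<eta>_act_natural[OF hg(1), of "\<eta> (omap (act g) x)"] by simp
    finally show ?thesis by simp
  qed
  have "(\<forall>h\<in>carrier G. \<forall>g\<in>carrier G.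
      ?\<xi> (h \<otimes>\<^bsub>G\<^esub> g) = ?\<xi> h \<cdot>\<^bsub>X\<^esub> amap (act h) (?\<xi> g)) \<longleftrightarrow>
    \<theta> \<cdot>\<^bsub>X\<^esub> amap U (amap F \<theta>) = \<theta> \<cdot>\<^bsub>X\<^esub> ?\<mu>" (is "?cocycle \<longleftrightarrow> ?assoc")
  proof
    assume ?cocycle
    \<comment> \<open>Equality out of \<open>T(T(x))\<close> is tested in two layers: first on the
      summands \<open>h(T(x))\<close>, then on each \<open>h(g(x))\<close> inside them.\<close>
    have "\<theta> \<cdot>\<^bsub>X\<^esub> ?\<mu> = \<theta> \<cdot>\<^bsub>X\<^esub> amap U (amap F \<theta>)"
    proof (rule \<eta>_jointly_epic[where x = ?T])
      fix h assume h: "h \<in> carrier G"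
      show "(\<theta> \<cdot>\<^bsub>X\<^esub> ?\<mu>) \<cdot>\<^bsub>X\<^esub> \<eta> (omap (act h) ?T) =
        (\<theta> \<cdot>\<^bsub>X\<^esub> amap U (amap F \<theta>)) \<cdot>\<^bsub>X\<^esub> \<eta> (omap (act h) ?T)"
      proof (rule act_\<eta>_jointly_epic[OF x h])
        fix g assume g: "g \<in> carrier G"
        show "((\<theta> \<cdot>\<^bsub>X\<^esub> ?\<mu>) \<cdot>\<^bsub>X\<^esub> \<eta> (omap (act h) ?T)) \<cdot>\<^bsub>X\<^esub> amap (act h) (\<eta> (omap (act g) x)) =
          ((\<theta> \<cdot>\<^bsub>X\<^esub> amap U (amap F \<theta>)) \<cdot>\<^bsub>X\<^esub> \<eta> (omap (act h) ?T)) \<cdot>\<^bsub>X\<^esub>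
            amap (act h) (\<eta> (omap (act g) x))"
          unfolding lhs[OF h g, symmetric] rhs[OF h g, symmetric]
          using \<open>?cocycle\<close> h g by blast
      qed (use h in \<open>auto simp: Hom_def\<close>)
    qed (auto simp: Hom_def)
    then show ?assoc by (rule sym)
  next
    assume ?assoc
    show ?cocycle
    proof (intro ballI)
      fix h g assume hg: "h \<in> carrier G" "g \<in> carrier G"
      show "?\<xi> (h \<otimes>\<^bsub>G\<^esub> g) = ?\<xi> h \<cdot>\<^bsub>X\<^esub> amap (act h) (?\<xi> g)"
        unfolding lhs[OF hg] rhs[OF hg] by (simp only: \<open>?assoc\<close>)
    qed
  qed
  \<comment> \<open>The unit law of the algebra is the normalisation of the cocycle at the neutral
    element, as \<open>1(x) = x\<close>.\<close>
  then show ?thesis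
    by (auto simp: Ob_EM algebra_cocycle_def Ob_Z1 Hom_def)
qed

text \<open>The existence half of the universal property assembles the components of \<xi> into one
  arrow \<theta>.\<close>

lemma algebra_cocycle_surj:
  assumes \<xi>: "(x, \<xi>) \<in> Ob (Z1 G X act)"
  shows "\<exists>A\<in>Ob EM. algebra_cocycle A = (x, \<xi>)"
proof -
  have "\<forall>g\<in>carrier G. \<xi> g \<in> Hom X (omap (act g) x) x" and x: "x \<in> Ob X"
    using \<xi> by (auto simp: Ob_Z1)
  then obtain \<theta> where \<theta>: "\<theta> \<in> Hom X (omap U (omap F x)) x"
    and "\<And>g. g \<in> carrier G \<Longrightarrow> \<theta> \<cdot>\<^bsub>X\<^esub> \<eta> (omap (act g) x) = \<xi> g"
    using is_coproduct_universal[OF coproduct_\<eta>[OF x] x, of \<xi>] by blast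
  then have "algebra_cocycle (x, \<theta>) = (x, \<xi>)"
    using \<xi> by (auto simp: algebra_cocycle_def Ob_Z1 PiE_iff extensional_def fun_eq_iff)
  then show ?thesis
    using algebra_iff_cocycle[OF x \<theta>] \<xi> by auto
qed

text \<open>An equation between arrows out of \<open>UF(x)\<close> holds iff it holds on each
  summand \<open>g(x)\<close>; there, naturality of \<eta> turns the algebra square into the cocycle
  square.\<close>

lemma algebra_morphism_iff_cocycle_morphism:
  assumes A: "A \<in> Ob EM" and B: "B \<in> Ob EM" and f: "f \<in> Hom X (fst A) (fst B)"
  shows "algebra_morphism A f B \<longleftrightarrow>
    cocycle_morphism G X act (algebra_cocycle A) f (algebra_cocycle B)"
proof -
  obtain x \<theta> y \<zeta> where eqs: "A = (x, \<theta>)" "B = (y, \<zeta>)" by (cases A; cases B)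
  let ?T = "omap U (omap F x)"
  have [simp]: "x \<in> Ob X" "\<theta> \<in> Arr X" "Dom X \<theta> = ?T" "Cod X \<theta> = x"
    "y \<in> Ob X" "\<zeta> \<in> Arr X" "Dom X \<zeta> = omap U (omap F y)" "Cod X \<zeta> = y"
    "f \<in> Arr X" "Dom X f = x" "Cod X f = y"
    using A B f by (auto simp: eqs Ob_EM Hom_def)
  have nat: "(\<zeta> \<cdot>\<^bsub>X\<^esub> \<eta> (omap (act g) y)) \<cdot>\<^bsub>X\<^esub> amap (act g) f =
      (\<zeta> \<cdot>\<^bsub>X\<^esub> amap U (amap F f)) \<cdot>\<^bsub>X\<^esub> \<eta> (omap (act g) x)" if [simp]: "g \<in> carrier G" for g
    using \<eta>_act_natural[of g f] by simp
  have "f \<cdot>\<^bsub>X\<^esub> \<theta> = \<zeta> \<cdot>\<^bsub>X\<^esub> amap U (amap F f) \<longleftrightarrow>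
    (\<forall>g\<in>carrier G. (f \<cdot>\<^bsub>X\<^esub> \<theta>) \<cdot>\<^bsub>X\<^esub> \<eta> (omap (act g) x) =
      (\<zeta> \<cdot>\<^bsub>X\<^esub> amap U (amap F f)) \<cdot>\<^bsub>X\<^esub> \<eta> (omap (act g) x))" (is "?l = ?r \<longleftrightarrow> ?eqs")
  proof
    assume ?eqs
    then show "?l = ?r"
      by (intro \<eta>_jointly_epic[of x ?l y ?r]) (auto simp: Hom_def)
  qed simp
  also have "\<dots> \<longleftrightarrow> (\<forall>g\<in>carrier G. f \<cdot>\<^bsub>X\<^esub> \<theta> \<cdot>\<^bsub>X\<^esub> \<eta> (omap (act g) x) =
      (\<zeta> \<cdot>\<^bsub>X\<^esub> \<eta> (omap (act g) y)) \<cdot>\<^bsub>X\<^esub> amap (act g) f)"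
    by (rule ball_cong[OF refl], subst nat) simp_all
  finally show ?thesis
    by (simp add: eqs algebra_morphism_def cocycle_morphism_def algebra_cocycle_def)
qed

section \<open>The equivalence between \<open>Y\<close> and the category of 1-cocycles\<close>

lemma is_equivalence_comparison: "is_equivalence Y EM (comparison_functor Y U \<epsilon>)"
  using U_monadic unfolding monadic_def .

lemma algebra_cocycle_fully_faithful:
  shows "is_functor EM (Z1 G X act) (structured_functor algebra_cocycle)"
    and "fully_faithful EM (Z1 G X act) (structured_functor algebra_cocycle)"
proof -
  interpret K: is_functor Y EM "comparison_functor Y U \<epsilon>"
    using is_equivalence_comparison unfolding is_equivalence_def by blast
  note ff = structured_functor_fully_faithful[where C = X and S = "Ob EM"
      and P = algebra_morphism and D = X and S' = "Ob (Z1 G X act)"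
      and P' = "cocycle_morphism G X act" and j = algebra_cocycle,
      folded Z1_eq_structured_category EM_eq_structured_category,
      OF K.D.category_axioms category_Z1]
  have Ob: "algebra_cocycle A \<in> Ob (Z1 G X act)" if "A \<in> Ob EM" for A
    using that algebra_iff_cocycle[of "fst A" "snd A"] by (cases A) (auto simp: Ob_EM)
  have fst: "fst (algebra_cocycle A) = fst A" for A
    by (simp add: algebra_cocycle_def split_def)
  have Hom: "f \<in> Hom X (fst A) (fst B) \<and> algebra_morphism A f B \<longleftrightarrow>
      f \<in> Hom X (fst (algebra_cocycle A)) (fst (algebra_cocycle B)) \<and>
      cocycle_morphism G X act (algebra_cocycle A) f (algebra_cocycle B)"
    if "A \<in> Ob EM" "B \<in> Ob EM" for A B f
    unfolding fst using algebra_morphism_iff_cocycle_morphism[OF that] by blast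
  show "is_functor EM (Z1 G X act) (structured_functor algebra_cocycle)"
    by (rule ff(1)[OF Ob Hom]) (simp_all add: fst)
  show "fully_faithful EM (Z1 G X act) (structured_functor algebra_cocycle)"
    by (rule ff(2)[OF Ob Hom]) (simp_all add: fst)
qed

abbreviation "L \<equiv> structured_functor algebra_cocycle \<circ>\<^sub>F comparison_functor Y U \<epsilon>"

text \<open>The comparison functor equips \<open>U(y)\<close> with the structure map
  \<open>U(\<epsilon> y)\<close>, whose restrictions to the summands form the induced
  cocycle.\<close>

lemma omap_L: "omap L y = (omap U y, induced_cocycle G X act U \<eta> \<epsilon> y)"
  by (simp add: comparison_functor_def algebra_cocycle_def induced_cocycle_def)

lemma L_equivalence:
  shows "is_functor Y (Z1 G X act) L" "fully_faithful Y (Z1 G X act) L"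
    "essentially_surjective Y (Z1 G X act) L"
proof -
  note K = is_equivalence_comparison
  have K_functor: "is_functor Y EM (comparison_functor Y U \<epsilon>)"
    using K unfolding is_equivalence_def by blast
  note Kff = equivalence_fully_faithful_essentially_surjective[OF K]
  interpret Z: category "Z1 G X act" by (rule category_Z1)
  have "essentially_surjective EM (Z1 G X act) (structured_functor algebra_cocycle)"
    unfolding essentially_surjective_def
  proof
    fix B assume B: "B \<in> Ob (Z1 G X act)"
    then obtain A where "A \<in> Ob EM" "algebra_cocycle A = B"
      using algebra_cocycle_surj[of "fst B" "snd B"] by auto
    then show "\<exists>A\<in>Ob EM. isomorphic (Z1 G X act) (omap (structured_functor algebra_cocycle) A) B"
      using Z.isomorphic_refl[OF B] by auto
  qed
  then show "essentially_surjective Y (Z1 G X act) L"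
    by (rule essentially_surjective_comp[OF algebra_cocycle_fully_faithful(1) Kff(2)])
  show "is_functor Y (Z1 G X act) L" "fully_faithful Y (Z1 G X act) L"
    using is_functor_comp[OF K_functor] fully_faithful_comp[OF K_functor Kff(1)]
      algebra_cocycle_fully_faithful by blast+
qed

text \<open>No cocycle law is computed here: the pair is the value at \<open>y\<close> of a functor
  into the category of 1-cocycles.\<close>

lemma induced_cocycle_Ob:
  "y \<in> Ob Y \<Longrightarrow> (omap U y, induced_cocycle G X act U \<eta> \<epsilon> y) \<in> Ob (Z1 G X act)"
  using is_functor.omap_closed[OF L_equivalence(1)] unfolding omap_L .

text \<open>Both categories embed fully faithfully into the 1-cocycles in \<open>X\<close>, one by
  \<open>L\<close> and one by untwisting. The common essential image consists of the cocycles whose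
  underlying object is isomorphic to \<open>U(y0)\<close>.\<close>

lemma forms_equivalent_twisted_cocycles:
  assumes y0: "y0 \<in> Ob Y"
  defines "\<xi>0 \<equiv> induced_cocycle G X act U \<eta> \<epsilon> y0"
  shows "equivalent_categories (forms_category X Y U y0)
    (Z1 G (one_object_category (End_monoid X (omap U y0))) (twisted_action X act \<xi>0))"
proof -
  interpret T: G_category_cocycle G X act "omap U y0" \<xi>0
    by unfold_locales (simp add: \<xi>0_def induced_cocycle_Ob[OF y0])
  interpret Z: category "Z1 G X act" by (rule category_Z1)
  let ?S = "{y. isomorphic X (omap U y) (omap U y0)}"
  have Ob: "Ob (forms_category X Y U y0) = Ob Y \<inter> ?S"
    by (simp add: forms_category_def full_subcategory_def)
  have incl: "is_functor (forms_category X Y U y0) Y id_functor"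
    "fully_faithful (forms_category X Y U y0) Y id_functor"
    unfolding forms_category_def by (rule full_subcategory_inclusion[OF F.D.category_axioms])+
  show ?thesis
  proof (rule equivalence_of_same_essential_image[OF is_functor_comp[OF incl(1) L_equivalence(1)]
        fully_faithful_comp[OF incl L_equivalence(2)] T.untwist_fully_faithful])
    fix y assume "y \<in> Ob (forms_category X Y U y0)"
    then have y: "y \<in> Ob Y" "isomorphic X (omap U y) (omap U y0)"
      by (auto simp: Ob)
    then obtain t where "t \<in> Hom X (omap U y) (omap U y0)" "is_iso X t"
      unfolding isomorphic_def by blast
    \<comment> \<open>Untwisting only produces cocycles on \<open>U(y0)\<close> itself, so the
      cocycle of \<open>y\<close> is first moved there along \<open>t\<close>.\<close>
    then obtain \<upsilon> where \<upsilon>: "isomorphic (Z1 G X act) (omap L y) (omap U y0, \<upsilon>)"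
      using transport_cocycle[OF induced_cocycle_Ob[OF y(1)]] unfolding omap_L by blast
    then obtain B where "B \<in> Ob (Z1 G T.E T.tw)" "T.untwist B = (omap U y0, \<upsilon>)"
      using T.untwist_surj Z.isomorphic_Ob by blast
    then show "\<exists>B\<in>Ob (Z1 G T.E T.tw).
        isomorphic (Z1 G X act) (omap (L \<circ>\<^sub>F id_functor) y) (omap (structured_functor T.untwist) B)"
      using \<upsilon> by (intro bexI[of _ B]) simp_all
  next
    fix B assume B: "B \<in> Ob (Z1 G T.E T.tw)"
    then obtain y where y: "y \<in> Ob Y" "isomorphic (Z1 G X act) (omap L y) (T.untwist B)"
      using L_equivalence(3) T.untwist_Ob unfolding essentially_surjective_def by blast
    \<comment> \<open>The object under an untwisted cocycle is \<open>U(y0)\<close>; forgetting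
      structure in the isomorphism then shows that \<open>y\<close> lies in the full
      subcategory.\<close>
    moreover obtain \<upsilon> where "T.untwist B = (omap U y0, \<upsilon>)"
      by (auto simp: T.untwist_def split_def)
    ultimately have "isomorphic X (omap U y) (omap U y0)"
      unfolding omap_L by (auto intro: isomorphic_Z1_underlying)
    then show "\<exists>y\<in>Ob (forms_category X Y U y0).
        isomorphic (Z1 G X act) (omap (L \<circ>\<^sub>F id_functor) y) (omap (structured_functor T.untwist) B)"
      using y by (intro bexI[of _ y]) (simp_all add: Ob)
  qed
qed

end

text \<open>The first conjunct certifies that the base family is a cocycle, so that twisting by it
  does give an action.\<close>

theorem theorem3p7:
  fixes G :: "('g, 'e) monoid_scheme"
    and X :: "('o, 'm) category"
    and act :: "'g \<Rightarrow> ('o, 'm, 'o, 'm) functor_data"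
    and Y :: "('p, 'n) category"
    and F :: "('o, 'm, 'p, 'n) functor_data"
    and U :: "('p, 'n, 'o, 'm) functor_data"
    and \<eta> :: "'o \<Rightarrow> 'm"
    and \<epsilon> :: "'p \<Rightarrow> 'n"
    and Y0 :: 'p
  assumes "G_galois_adjunction G X act Y F U \<eta> \<epsilon>"
    and "Y0 \<in> Ob Y"
  defines "\<xi>0 \<equiv> induced_cocycle G X act U \<eta> \<epsilon> Y0"
  defines "E \<equiv> one_object_category (End_monoid X (omap U Y0))"
  defines "A \<equiv> one_object_category (Aut_group X (omap U Y0))"
  shows "(omap U Y0, \<xi>0) \<in> Ob (Z1 G X act)
    \<and> equivalent_categories (forms_category X Y U Y0) (Z1 G E (twisted_action X act \<xi>0))
    \<and> (\<exists>b. bij_betw b (iso_classes (forms_category X Y U Y0)) (H1 G E (twisted_action X act \<xi>0)))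
    \<and> H1 G E (twisted_action X act \<xi>0) = H1 G A (twisted_action X act \<xi>0)"
proof -
  interpret G_galois_adjunction G X act Y F U \<eta> \<epsilon> by fact
  interpret T: G_category_cocycle G X act "omap U Y0" \<xi>0
    by unfold_locales (simp add: \<xi>0_def induced_cocycle_Ob[OF assms(2)])
  have equiv: "equivalent_categories (forms_category X Y U Y0) (Z1 G E (twisted_action X act \<xi>0))"
    unfolding \<xi>0_def E_def by (rule forms_equivalent_twisted_cocycles[OF assms(2)])
  show ?thesis
    using T.cocycle equiv equivalent_categories_iso_classes[OF equiv] T.H1_E_eq_H1_A
    unfolding H1_def E_def A_def by blast
qed

end
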